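(* Let $(M,N)$ be an abstract divisorial space over $\mathbb K$ and $b\in M_{\ge0}$. Let $\widehat N^b:=\widehat N^{d_b}$ and endow $\widehat M^b:=\widehat N^b-\widehat N^b\subset\widehat M^{d_b}$ with the induced topology. Then the cone $\widehat N^b$ is Hausdorff complete and the cone $\widehat M^b_{\ge0}:=\widehat M^{d_b}_{\ge0}\cap\widehat M^b$ is closed in $\widehat M^b$. Moreover, $(\widehat M^b,\widehat N^b)$ is an abstract divisorial space over $\mathbb K$ with partial order defined by $\widehat M^b_{\ge0}$. The natural map $(M,N)\to(\widehat M^b,\widehat N^b)$ is a morphism which satisfies the following universal property: for any abstract divisorial space $(M',N')$ over $\mathbb K$ endowed with the $b'$-topology for some $b'\in M'_{\ge0}$ and any morphism $\varphi\colon(M,N)\to(M',N')$ such that $N'$ is Hausdorff complete, $M'_{\ge0}$ is closed in $M'$ and $\varphi(b)\le b'$, there is a unique morphism $\widehat\varphi\colon(\widehat M^b,\widehat N^b)\to(M',N')$ whose composition with the natural map $(M,N)\to(\widehat M^b,\widehat N^b)$ is $\varphi$.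
   Context: Let $\mathbb K$ be $\mathbb Q$ or $\mathbb R$. An ordered $\mathbb K$-vector space is a $\mathbb K$-vector space $M$ with a partial order compatible with addition and with multiplication by scalars in $\mathbb K_{\ge0}$; $M_{\ge0}=\{x\in M\mid x\ge0\}$. A cone is a subset $C$ with $C+C\subset C$ and $\mathbb K_{\ge0}C\subset C$. An abstract divisorial space over $\mathbb K$ is a pair $(M,N)$ with $M$ an ordered $\mathbb K$-vector space and $N$ a cone in $M$ with $M=N-N$. A morphism $(M,N)\to(M',N')$ is a $\mathbb K$-linear map $\varphi\colon M\to M'$ with $\varphi(M_{\ge0})\subset M'_{\ge0}$ and $\varphi(N)\subset N'$. For $b\in M_{\ge0}$, the $b$-topology on $M$ is the topology of the pseudo-metric $d_b(x,y)=\min\{\inf\{\delta\in\mathbb K_{\ge0}\mid-\delta b\le x-y\le\delta b\},1\}$. $\widehat M^{d_b}$ is the (Hausdorff) completion of $M$ with respect to $d_b$, a $\mathbb K$-vector space (the map $M\to\widehat M^{d_b}$ need not be injective); $\widehat N^{d_b}$ and $\widehat M_{\ge0}^{d_b}$ denote the completions of $N$ and of $M_{\ge0}$, viewed as the closures of their images in $\widehat M^{d_b}$. *)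

theory Defs
  imports "HOL-Analysis.Analysis" "HOL-Algebra.Module"
begin

text \<open>
  The base field \<open>K\<close> is a set of reals, either \<open>\<rat>\<close> or \<open>\<real>\<close>. Spaces are modules with an explicit
  carrier, because the spaces built below are subspaces of quotients that depend on \<open>M\<close> and \<open>b\<close>.
  The ring multiplication and unit of a \<open>module\<close> record play no role.
\<close>

definition scalar_field :: "real set \<Rightarrow> real ring" where
  "scalar_field K = \<lparr>carrier = K, mult = (*), one = 1, zero = 0, add = (+)\<rparr>"

record ('k, 'a) ordered_module = "('k, 'a) module" +
  le :: "['a, 'a] \<Rightarrow> bool" (infix \<open>\<preceq>\<index>\<close> 50)

locale ordered_vector_space = module "scalar_field K" M
  for K and M :: "(real, 'a) ordered_module" (structure) +
  assumes partial_order: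
      "partial_order_on (carrier M) {(x, y). x \<in> carrier M \<and> y \<in> carrier M \<and> x \<preceq> y}"
    and add_mono:
      "\<lbrakk>x \<in> carrier M; y \<in> carrier M; z \<in> carrier M; x \<preceq> y\<rbrakk> \<Longrightarrow> x \<oplus> z \<preceq> y \<oplus> z"
    and smult_mono:
      "\<lbrakk>a \<in> K; 0 \<le> a; x \<in> carrier M; y \<in> carrier M; x \<preceq> y\<rbrakk> \<Longrightarrow> a \<odot>\<^bsub>M\<^esub> x \<preceq> a \<odot>\<^bsub>M\<^esub> y"

definition nonneg_part :: "(real, 'a) ordered_module \<Rightarrow> 'a set" where
  "nonneg_part M = {x \<in> carrier M. \<zero>\<^bsub>M\<^esub> \<preceq>\<^bsub>M\<^esub> x}"

definition is_cone :: "real set \<Rightarrow> (real, 'a, 'z) module_scheme \<Rightarrow> 'a set \<Rightarrow> bool" where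
  "is_cone K M C \<longleftrightarrow> C \<subseteq> carrier M \<and> (\<forall>x\<in>C. \<forall>y\<in>C. x \<oplus>\<^bsub>M\<^esub> y \<in> C) \<and>
     (\<forall>a\<in>K. 0 \<le> a \<longrightarrow> (\<forall>x\<in>C. a \<odot>\<^bsub>M\<^esub> x \<in> C))"

definition differences :: "('a, 'z) ring_scheme \<Rightarrow> 'a set \<Rightarrow> 'a set" where
  "differences M C = {x \<ominus>\<^bsub>M\<^esub> y | x y. x \<in> C \<and> y \<in> C}"

locale abstract_divisorial_space = ordered_vector_space K M
  for K and M :: "(real, 'a) ordered_module" (structure) and N +
  assumes cone: "is_cone K M N"
    and generating: "carrier M = differences M N"

text \<open>Only the values of a morphism on \<open>carrier M\<close> are meaningful.\<close>

definition divisorial_hom ::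
    "real set \<Rightarrow> (real, 'a) ordered_module \<Rightarrow> 'a set \<Rightarrow> (real, 'c) ordered_module \<Rightarrow> 'c set
      \<Rightarrow> ('a \<Rightarrow> 'c) set" where
  "divisorial_hom K M N M' N' = {\<phi> \<in> hom (add_monoid M) (add_monoid M').
     (\<forall>a\<in>K. \<forall>x\<in>carrier M. \<phi> (a \<odot>\<^bsub>M\<^esub> x) = a \<odot>\<^bsub>M'\<^esub> \<phi> x) \<and>
     \<phi> ` nonneg_part M \<subseteq> nonneg_part M' \<and> \<phi> ` N \<subseteq> N'}"


text \<open>
  The infimum is taken in \<open>ereal\<close>, where the infimum of the empty set is \<open>\<infinity>\<close>. Outside the carrier the
  pseudo-metric is set to \<open>0\<close>, so that it is nonnegative and symmetric everywhere, as
  \<^locale>\<open>Metric_space\<close> requires.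
\<close>

definition b_dist :: "real set \<Rightarrow> (real, 'a) ordered_module \<Rightarrow> 'a \<Rightarrow> 'a \<Rightarrow> 'a \<Rightarrow> real" where
  "b_dist K M b x y =
    (if x \<in> carrier M \<and> y \<in> carrier M
     then real_of_ereal (min (Inf (ereal ` {\<delta> \<in> K. 0 \<le> \<delta> \<and>
            \<ominus>\<^bsub>M\<^esub> (\<delta> \<odot>\<^bsub>M\<^esub> b) \<preceq>\<^bsub>M\<^esub> x \<ominus>\<^bsub>M\<^esub> y \<and> x \<ominus>\<^bsub>M\<^esub> y \<preceq>\<^bsub>M\<^esub> \<delta> \<odot>\<^bsub>M\<^esub> b})) 1)
     else 0)"

text \<open>
  The constants of \<^locale>\<open>Metric_space\<close> are specified for metrics only, whereas \<open>b_dist\<close> is a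
  pseudo-metric, so the topology, Cauchy sequences and completeness are spelled out here. For
  metrics they agree with the library notions, as shown below.
\<close>

definition pm_topology :: "'a set \<Rightarrow> ('a \<Rightarrow> 'a \<Rightarrow> real) \<Rightarrow> 'a topology" where
  "pm_topology S d =
     topology (\<lambda>U. U \<subseteq> S \<and> (\<forall>x\<in>U. \<exists>r>0. \<forall>y\<in>S. d x y < r \<longrightarrow> y \<in> U))"

definition pm_Cauchy :: "'a set \<Rightarrow> ('a \<Rightarrow> 'a \<Rightarrow> real) \<Rightarrow> (nat \<Rightarrow> 'a) \<Rightarrow> bool" where
  "pm_Cauchy S d \<sigma> \<longleftrightarrow>
     range \<sigma> \<subseteq> S \<and> (\<forall>\<epsilon>>0. \<exists>n0. \<forall>m\<ge>n0. \<forall>n\<ge>n0. d (\<sigma> m) (\<sigma> n) < \<epsilon>)"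

definition pm_complete :: "'a set \<Rightarrow> ('a \<Rightarrow> 'a \<Rightarrow> real) \<Rightarrow> bool" where
  "pm_complete S d \<longleftrightarrow>
     (\<forall>\<sigma>. pm_Cauchy S d \<sigma> \<longrightarrow> (\<exists>x. limitin (pm_topology S d) \<sigma> x sequentially))"

lemma istopology_pm_topology:
  "istopology (\<lambda>U. U \<subseteq> S \<and> (\<forall>x\<in>U. \<exists>r>0. \<forall>y\<in>S. (d :: 'a \<Rightarrow> 'a \<Rightarrow> real) x y < r \<longrightarrow> y \<in> U))"
  unfolding istopology_def
proof (intro conjI allI impI ballI)
  fix U V x
  assume U: "U \<subseteq> S \<and> (\<forall>x\<in>U. \<exists>r>0. \<forall>y\<in>S. d x y < r \<longrightarrow> y \<in> U)"
    and V: "V \<subseteq> S \<and> (\<forall>x\<in>V. \<exists>r>0. \<forall>y\<in>S. d x y < r \<longrightarrow> y \<in> V)"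
    and x: "x \<in> U \<inter> V"
  obtain r where r: "r > 0" "\<forall>y\<in>S. d x y < r \<longrightarrow> y \<in> U" using U x by blast
  obtain s where s: "s > 0" "\<forall>y\<in>S. d x y < s \<longrightarrow> y \<in> V" using V x by blast
  show "\<exists>r>0. \<forall>y\<in>S. d x y < r \<longrightarrow> y \<in> U \<inter> V"
    using r s by (intro exI[of _ "min r s"]) auto
next
  fix \<K> x
  assume K: "\<forall>U\<in>\<K>. U \<subseteq> S \<and> (\<forall>x\<in>U. \<exists>r>0. \<forall>y\<in>S. d x y < r \<longrightarrow> y \<in> U)"
    and "x \<in> \<Union>\<K>"
  then obtain U where U: "U \<in> \<K>" "x \<in> U" by blast
  then obtain r where "r > 0" "\<forall>y\<in>S. d x y < r \<longrightarrow> y \<in> U" using K by blast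
  then show "\<exists>r>0. \<forall>y\<in>S. d x y < r \<longrightarrow> y \<in> \<Union>\<K>" using U by blast
qed blast+

lemma openin_pm_topology:
  "openin (pm_topology S d) U \<longleftrightarrow> U \<subseteq> S \<and> (\<forall>x\<in>U. \<exists>r>0. \<forall>y\<in>S. d x y < r \<longrightarrow> y \<in> U)"
  unfolding pm_topology_def by (subst topology_inverse'[OF istopology_pm_topology]) (rule refl)

lemma pm_topology_eq_mtopology:
  assumes "Metric_space S d"
  shows "pm_topology S d = Metric_space.mtopology S d"
proof -
  interpret Metric_space S d by fact
  show ?thesis
    unfolding topology_eq openin_pm_topology openin_mtopology subset_iff in_mball by blast
qed

lemma pm_Cauchy_eq_MCauchy: "Metric_space S d \<Longrightarrow> pm_Cauchy S d = Metric_space.MCauchy S d"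
  by (auto simp: fun_eq_iff pm_Cauchy_def Metric_space.MCauchy_def)

lemma pm_complete_eq_mcomplete: "Metric_space S d \<Longrightarrow> pm_complete S d = Metric_space.mcomplete S d"
  by (simp add: pm_complete_def Metric_space.mcomplete_def pm_Cauchy_eq_MCauchy
      pm_topology_eq_mtopology)

definition hausdorff_complete :: "'a set \<Rightarrow> ('a \<Rightarrow> 'a \<Rightarrow> real) \<Rightarrow> bool" where
  "hausdorff_complete S d \<longleftrightarrow> Hausdorff_space (pm_topology S d) \<and> pm_complete S d"


text \<open>
  The Hausdorff completion: Cauchy sequences modulo sequences at distance tending to \<open>0\<close>.
\<close>

definition cauchy_rel :: "'a set \<Rightarrow> ('a \<Rightarrow> 'a \<Rightarrow> real) \<Rightarrow> (nat \<Rightarrow> 'a) rel" where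
  "cauchy_rel S d = {(\<sigma>, \<tau>). pm_Cauchy S d \<sigma> \<and> pm_Cauchy S d \<tau> \<and>
     (\<lambda>n. d (\<sigma> n) (\<tau> n)) \<longlonglongrightarrow> 0}"

definition cauchy_class :: "'a set \<Rightarrow> ('a \<Rightarrow> 'a \<Rightarrow> real) \<Rightarrow> (nat \<Rightarrow> 'a) \<Rightarrow> (nat \<Rightarrow> 'a) set" where
  "cauchy_class S d \<sigma> = cauchy_rel S d `` {\<sigma>}"

definition completion_set :: "'a set \<Rightarrow> ('a \<Rightarrow> 'a \<Rightarrow> real) \<Rightarrow> (nat \<Rightarrow> 'a) set set" where
  "completion_set S d = {\<sigma>. pm_Cauchy S d \<sigma>} // cauchy_rel S d"

text \<open>The value on two classes is the common limit over all choices of representatives.\<close>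

definition completion_dist ::
    "'a set \<Rightarrow> ('a \<Rightarrow> 'a \<Rightarrow> real) \<Rightarrow> (nat \<Rightarrow> 'a) set \<Rightarrow> (nat \<Rightarrow> 'a) set \<Rightarrow> real" where
  "completion_dist S d X Y =
    (if X \<in> completion_set S d \<and> Y \<in> completion_set S d
     then the_elem (\<Union>\<sigma>\<in>X. \<Union>\<tau>\<in>Y. {lim (\<lambda>n. d (\<sigma> n) (\<tau> n))})
     else 0)"

definition completion_topology :: "'a set \<Rightarrow> ('a \<Rightarrow> 'a \<Rightarrow> real) \<Rightarrow> (nat \<Rightarrow> 'a) set topology" where
  "completion_topology S d = pm_topology (completion_set S d) (completion_dist S d)"

definition completion_map :: "'a set \<Rightarrow> ('a \<Rightarrow> 'a \<Rightarrow> real) \<Rightarrow> 'a \<Rightarrow> (nat \<Rightarrow> 'a) set" where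
  "completion_map S d x = cauchy_class S d (\<lambda>n. x)"

text \<open>
  The operations are induced by the pointwise operations on Cauchy sequences; the unions run over
  representatives, all of which give the same class.
\<close>

definition b_completion ::
    "real set \<Rightarrow> (real, 'a) ordered_module \<Rightarrow> 'a \<Rightarrow> (real, (nat \<Rightarrow> 'a) set) module" where
  "b_completion K M b =
    (let cls = cauchy_class (carrier M) (b_dist K M b) in
     \<lparr>carrier = completion_set (carrier M) (b_dist K M b),
      mult = undefined,
      one = undefined,
      zero = cls (\<lambda>n. \<zero>\<^bsub>M\<^esub>),
      add = (\<lambda>X Y. \<Union>\<sigma>\<in>X. \<Union>\<tau>\<in>Y. cls (\<lambda>n. \<sigma> n \<oplus>\<^bsub>M\<^esub> \<tau> n)),
      smult = (\<lambda>a X. \<Union>\<sigma>\<in>X. cls (\<lambda>n. a \<odot>\<^bsub>M\<^esub> \<sigma> n))\<rparr>)"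

definition b_completion_dist ::
    "real set \<Rightarrow> (real, 'a) ordered_module \<Rightarrow> 'a \<Rightarrow> (nat \<Rightarrow> 'a) set \<Rightarrow> (nat \<Rightarrow> 'a) set \<Rightarrow> real" where
  "b_completion_dist K M b = completion_dist (carrier M) (b_dist K M b)"

definition b_completion_topology ::
    "real set \<Rightarrow> (real, 'a) ordered_module \<Rightarrow> 'a \<Rightarrow> (nat \<Rightarrow> 'a) set topology" where
  "b_completion_topology K M b = completion_topology (carrier M) (b_dist K M b)"

definition natural_map ::
    "real set \<Rightarrow> (real, 'a) ordered_module \<Rightarrow> 'a \<Rightarrow> 'a \<Rightarrow> (nat \<Rightarrow> 'a) set" where
  "natural_map K M b = completion_map (carrier M) (b_dist K M b)"

text \<open>The completion of a subset of \<open>M\<close>, as a subset of the completion of \<open>M\<close>.\<close>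

definition subset_completion ::
    "real set \<Rightarrow> (real, 'a) ordered_module \<Rightarrow> 'a \<Rightarrow> 'a set \<Rightarrow> (nat \<Rightarrow> 'a) set set" where
  "subset_completion K M b A = b_completion_topology K M b closure_of (natural_map K M b ` A)"

definition hat_carrier ::
    "real set \<Rightarrow> (real, 'a) ordered_module \<Rightarrow> 'a set \<Rightarrow> 'a \<Rightarrow> (nat \<Rightarrow> 'a) set set" where
  "hat_carrier K M N b = differences (b_completion K M b) (subset_completion K M b N)"

definition hat_nonneg ::
    "real set \<Rightarrow> (real, 'a) ordered_module \<Rightarrow> 'a set \<Rightarrow> 'a \<Rightarrow> (nat \<Rightarrow> 'a) set set" where
  "hat_nonneg K M N b = subset_completion K M b (nonneg_part M) \<inter> hat_carrier K M N b"

definition hat_space ::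
    "real set \<Rightarrow> (real, 'a) ordered_module \<Rightarrow> 'a set \<Rightarrow> 'a
      \<Rightarrow> (real, (nat \<Rightarrow> 'a) set) ordered_module" where
  "hat_space K M N b =
    (let C = b_completion K M b in
     \<lparr>carrier = hat_carrier K M N b,
      mult = mult C,
      one = one C,
      zero = zero C,
      add = add C,
      smult = smult C,
      le = (\<lambda>x y. y \<ominus>\<^bsub>C\<^esub> x \<in> hat_nonneg K M N b)\<rparr>)"

end

theory Submission
  imports Defs
begin

text \<open>
  Everything is computed with representatives. An element of the completion of \<open>M\<close> lies in the
  completion of a subset \<open>A\<close> if and only if some Cauchy sequence in \<open>A\<close> represents it
  (\<open>mem_closure_of_image_iff\<close>). Addition and scalar multiplication are Lipschitz for \<open>d\<^sub>b\<close>, so they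
  act on Cauchy sequences term by term, and the completion of a cone is again a cone. Replacing the
  terms of a Cauchy sequence of classes by nearby elements of \<open>A\<close> shows that the completion of \<open>A\<close>
  is complete (\<open>hausdorff_complete_closure_of_image\<close>).

  The order on the completed space is antisymmetric because intervals control the metric: if \<open>X\<close>
  and \<open>- X\<close> are represented by nonnegative sequences \<open>\<sigma>\<close> and \<open>\<tau>\<close>, then \<open>\<sigma> + \<tau>\<close> tends to \<open>0\<close>, and
  \<open>0 \<le> \<sigma> \<le> \<sigma> + \<tau>\<close> forces \<open>\<sigma>\<close> to tend to \<open>0\<close> (\<open>completed_nonneg_pointed\<close>).

  For the universal property, a morphism \<open>\<phi>\<close> with \<open>\<phi> b \<le> b'\<close> sends \<open>[- \<delta> b, \<delta> b]\<close> into
  \<open>[- \<delta> b', \<delta> b']\<close> and hence does not increase distances (\<open>divisorial_hom_nonexpanding\<close>). Relate a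
  class \<open>X\<close> to \<open>y \<in> M'\<close> when \<open>\<phi>\<close> tends to \<open>y\<close> along a representative of \<open>X\<close>. This relation is
  linear. It is single-valued because \<open>M' = N' - N'\<close> is Hausdorff as soon as \<open>N'\<close> is. It is defined on
  the completion of \<open>N\<close>, with values in \<open>N'\<close>, because \<open>N'\<close> is complete, and therefore on all
  differences of such elements. It respects the order because \<open>M'\<^sub>\<ge>\<^sub>0\<close> is closed. So it is the graph of
  the required extension. Conversely, a morphism \<open>\<psi>\<close> out of the completed space is not assumed to be
  continuous, but it is: the argument that shows that \<open>\<phi>\<close> does not increase distances applies to the
  topology that the image of \<open>b\<close> defines on the completed space, and the completed metric dominates
  that of this topology (\<open>dist_H_le\<close>). Hence \<open>\<psi>\<close> is determined by its values on the image of \<open>M\<close>.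
\<close>

section \<open>The Hausdorff completion of a pseudo-metric space\<close>

lemma null_squeeze:
  fixes f g :: "nat \<Rightarrow> real"
  assumes "g \<longlonglongrightarrow> 0" and "\<And>n. 0 \<le> f n" and "\<And>n. f n \<le> g n"
  shows "f \<longlonglongrightarrow> 0"
  using assms by (intro tendsto_sandwich[of "\<lambda>n. 0" f sequentially g 0]) auto

text \<open>
  The one estimate behind all constructions of Cauchy sequences below. Two sequences are allowed on the
  right so that it covers sums; the metric on the left may belong to another space, so that it covers
  images under morphisms.
\<close>

lemma pm_Cauchy_dominated:
  assumes "pm_Cauchy S d \<sigma>" "pm_Cauchy T e \<tau>" and "\<And>n. f n \<in> U"
    and le: "\<And>m n. d' (f m) (f n) \<le> c * (d (\<sigma> m) (\<sigma> n) + e (\<tau> m) (\<tau> n))" and "0 < c"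
  shows "pm_Cauchy U d' f"
proof -
  have "\<exists>n0. \<forall>m\<ge>n0. \<forall>n\<ge>n0. d' (f m) (f n) < r" if "0 < r" for r
  proof -
    have "0 < r / (2 * c)" using that \<open>0 < c\<close> by simp
    then obtain n1 n2 where n1: "\<And>m n. m \<ge> n1 \<Longrightarrow> n \<ge> n1 \<Longrightarrow> d (\<sigma> m) (\<sigma> n) < r / (2 * c)"
      and n2: "\<And>m n. m \<ge> n2 \<Longrightarrow> n \<ge> n2 \<Longrightarrow> e (\<tau> m) (\<tau> n) < r / (2 * c)"
      using assms(1,2) unfolding pm_Cauchy_def by meson
    have "d' (f m) (f n) < r" if "m \<ge> max n1 n2" "n \<ge> max n1 n2" for m n
    proof -
      have "d (\<sigma> m) (\<sigma> n) + e (\<tau> m) (\<tau> n) < r / (2 * c) + r / (2 * c)"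
        using that n1 n2 by (intro add_strict_mono) auto
      also have "\<dots> = r / c" using \<open>0 < c\<close> by (simp add: field_simps)
      finally have "c * (d (\<sigma> m) (\<sigma> n) + e (\<tau> m) (\<tau> n)) < c * (r / c)"
        using \<open>0 < c\<close> by (rule mult_strict_left_mono)
      then show ?thesis
        using le[of m n] \<open>0 < c\<close> by simp
    qed
    then show ?thesis by blast
  qed
  then show ?thesis
    using assms(3) by (auto simp: pm_Cauchy_def)
qed

locale pseudo_metric =
  fixes S :: "'a set" and d :: "'a \<Rightarrow> 'a \<Rightarrow> real"
  assumes nonneg: "0 \<le> d x y"
    and commute: "d x y = d y x"
    and refl: "x \<in> S \<Longrightarrow> d x x = 0"
    and triangle: "\<lbrakk>x \<in> S; y \<in> S; z \<in> S\<rbrakk> \<Longrightarrow> d x z \<le> d x y + d y z"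
begin

lemma topspace_pm_topology: "topspace (pm_topology S d) = S"
proof
  show "topspace (pm_topology S d) \<subseteq> S"
    using openin_pm_topology openin_topspace by metis
  have "openin (pm_topology S d) S"
    by (auto simp: openin_pm_topology intro: exI[of _ 1])
  then show "S \<subseteq> topspace (pm_topology S d)"
    by (rule openin_subset)
qed

lemma openin_ball: "openin (pm_topology S d) {y \<in> S. d x y < r}" if "x \<in> S"
  unfolding openin_pm_topology
proof (intro conjI ballI)
  fix y assume y: "y \<in> {y \<in> S. d x y < r}"
  have "d x z < r" if "z \<in> S" "d y z < r - d x y" for z
    using triangle[of x y z] y that \<open>x \<in> S\<close> by auto
  then show "\<exists>e>0. \<forall>z\<in>S. d y z < e \<longrightarrow> z \<in> {y \<in> S. d x y < r}"
    using y by (intro exI[of _ "r - d x y"]) auto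
qed auto

lemma limitin_pm_topology:
  assumes \<sigma>: "range \<sigma> \<subseteq> S"
  shows "limitin (pm_topology S d) \<sigma> x sequentially \<longleftrightarrow> x \<in> S \<and> (\<lambda>n. d (\<sigma> n) x) \<longlonglongrightarrow> 0"
proof
  assume lim: "limitin (pm_topology S d) \<sigma> x sequentially"
  then have x: "x \<in> S"
    by (simp add: limitin_def topspace_pm_topology)
  have "\<forall>\<^sub>F n in sequentially. \<bar>d (\<sigma> n) x\<bar> < e" if "e > 0" for e
  proof -
    have "\<forall>\<^sub>F n in sequentially. \<sigma> n \<in> {y \<in> S. d x y < e}"
    proof -
      have "x \<in> {y \<in> S. d x y < e}"
        using x that refl[OF x] by simp
      then show ?thesis
        using lim openin_ball[OF x, of e] unfolding limitin_def by blast
    qed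
    then show ?thesis
      by eventually_elim (use nonneg commute in \<open>auto simp: abs_of_nonneg\<close>)
  qed
  then show "x \<in> S \<and> (\<lambda>n. d (\<sigma> n) x) \<longlonglongrightarrow> 0"
    using x by (simp add: tendsto_iff dist_real_def)
next
  assume x: "x \<in> S \<and> (\<lambda>n. d (\<sigma> n) x) \<longlonglongrightarrow> 0"
  have "\<forall>\<^sub>F n in sequentially. \<sigma> n \<in> U" if U: "openin (pm_topology S d) U" "x \<in> U" for U
  proof -
    obtain r where r: "r > 0" "\<And>y. y \<in> S \<Longrightarrow> d x y < r \<Longrightarrow> y \<in> U"
      using U unfolding openin_pm_topology by blast
    have "\<forall>\<^sub>F n in sequentially. d (\<sigma> n) x < r"
      using x r(1) by (auto dest: order_tendstoD(2))
    then show ?thesis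
      by eventually_elim (metis r(2) \<sigma> commute range_subsetD)
  qed
  then show "limitin (pm_topology S d) \<sigma> x sequentially"
    using x by (simp add: limitin_def topspace_pm_topology)
qed

lemma closedin_limit:
  assumes "closedin (pm_topology S d) C" and "range \<sigma> \<subseteq> C" and "x \<in> S"
    and "(\<lambda>n. d (\<sigma> n) x) \<longlonglongrightarrow> 0"
  shows "x \<in> C"
proof -
  have "C \<subseteq> S"
    using closedin_subset[OF assms(1)] topspace_pm_topology by simp
  then have "limitin (pm_topology S d) \<sigma> x sequentially"
    using assms by (subst limitin_pm_topology) auto
  then show ?thesis
    using assms(1,2) by (intro limitin_closedin[of _ \<sigma> x sequentially C]) (auto simp: eventually_sequentially)
qed

text \<open>
  Points at distance \<open>0\<close> lie in the same open sets.
\<close>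

lemma Hausdorff_dist_zero:
  assumes "Hausdorff_space (pm_topology S d)" and "x \<in> S" "y \<in> S" "d x y = 0"
  shows "x = y"
proof (rule ccontr)
  assume "x \<noteq> y"
  then have "\<exists>U V. openin (pm_topology S d) U \<and> openin (pm_topology S d) V \<and> x \<in> U \<and> y \<in> V \<and> disjnt U V"
    using assms(1-3) unfolding Hausdorff_space_def topspace_pm_topology by blast
  then obtain U V where "openin (pm_topology S d) U" "x \<in> U" "y \<in> V" "disjnt U V"
    by blast
  then show False
    using assms by (auto simp: openin_pm_topology disjnt_iff)
qed

lemma subspace: "T \<subseteq> S \<Longrightarrow> pseudo_metric T d"
  by (intro pseudo_metric.intro nonneg commute) (simp_all add: refl triangle subset_iff)

text \<open>
  The distance is Lipschitz in both arguments, hence converges along Cauchy sequences.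
\<close>

lemma triangle_diff:
  assumes "x \<in> S" "y \<in> S" "x' \<in> S" "y' \<in> S"
  shows "\<bar>d x y - d x' y'\<bar> \<le> d x x' + d y y'"
  using triangle[of x x' y] triangle[of x' y' y] triangle[of x' x y'] triangle[of x y y'] assms
    commute[of x x'] commute[of y y'] by linarith

lemma CauchyD: "pm_Cauchy S d \<sigma> \<Longrightarrow> \<sigma> n \<in> S"
  by (auto simp: pm_Cauchy_def)

lemma Cauchy_const: "x \<in> S \<Longrightarrow> pm_Cauchy S d (\<lambda>n. x)"
  by (auto simp: pm_Cauchy_def refl)

lemma equiv_cauchy_rel: "equiv {\<sigma>. pm_Cauchy S d \<sigma>} (cauchy_rel S d)"
proof (rule equivI)
  show "cauchy_rel S d \<subseteq> {\<sigma>. pm_Cauchy S d \<sigma>} \<times> {\<sigma>. pm_Cauchy S d \<sigma>}"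
    by (auto simp: cauchy_rel_def)
  show "refl_on {\<sigma>. pm_Cauchy S d \<sigma>} (cauchy_rel S d)"
    by (auto simp: refl_on_def cauchy_rel_def refl CauchyD)
  show "sym (cauchy_rel S d)"
    using commute by (auto simp: sym_def cauchy_rel_def)
  show "trans (cauchy_rel S d)"
  proof (rule transI)
    fix \<sigma> \<tau> \<upsilon> assume h: "(\<sigma>, \<tau>) \<in> cauchy_rel S d" "(\<tau>, \<upsilon>) \<in> cauchy_rel S d"
    have "(\<lambda>n. d (\<sigma> n) (\<tau> n) + d (\<tau> n) (\<upsilon> n)) \<longlonglongrightarrow> 0 + 0"
      using h by (intro tendsto_add) (auto simp: cauchy_rel_def)
    then have "(\<lambda>n. d (\<sigma> n) (\<upsilon> n)) \<longlonglongrightarrow> 0"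
      using h by (intro null_squeeze[OF _ nonneg triangle]) (auto simp: cauchy_rel_def CauchyD)
    then show "(\<sigma>, \<upsilon>) \<in> cauchy_rel S d"
      using h by (auto simp: cauchy_rel_def)
  qed
qed

abbreviation "cls \<equiv> cauchy_class S d"

lemma cls_eq_iff:
  assumes "pm_Cauchy S d \<sigma>" "pm_Cauchy S d \<tau>"
  shows "cls \<sigma> = cls \<tau> \<longleftrightarrow> (\<lambda>n. d (\<sigma> n) (\<tau> n)) \<longlonglongrightarrow> 0"
  using eq_equiv_class_iff[OF equiv_cauchy_rel, of \<sigma> \<tau>] assms
  by (auto simp: cauchy_class_def cauchy_rel_def)

lemma mem_cls_iff:
  assumes "pm_Cauchy S d \<sigma>"
  shows "\<tau> \<in> cls \<sigma> \<longleftrightarrow> pm_Cauchy S d \<tau> \<and> cls \<tau> = cls \<sigma>"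
  using assms cls_eq_iff[of \<sigma> \<tau>] by (auto simp: cauchy_class_def cauchy_rel_def)

text \<open>
  Dropping finitely many terms does not change the class, so a property that holds eventually can be
  assumed of all terms of a representative.
\<close>

lemma cls_shift:
  assumes "pm_Cauchy S d \<sigma>"
  shows "pm_Cauchy S d (\<lambda>n. \<sigma> (n + k))" and "cls (\<lambda>n. \<sigma> (n + k)) = cls \<sigma>"
proof -
  have small: "\<exists>n0. \<forall>m\<ge>n0. \<forall>n\<ge>n0. d (\<sigma> m) (\<sigma> n) < \<epsilon>" if "\<epsilon> > 0" for \<epsilon>
    using assms that by (simp add: pm_Cauchy_def)
  show C: "pm_Cauchy S d (\<lambda>n. \<sigma> (n + k))"
    unfolding pm_Cauchy_def
  proof (intro conjI allI impI)
    show "range (\<lambda>n. \<sigma> (n + k)) \<subseteq> S" using assms CauchyD by blast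
    show "\<exists>n0. \<forall>m\<ge>n0. \<forall>n\<ge>n0. d (\<sigma> (m + k)) (\<sigma> (n + k)) < \<epsilon>" if "\<epsilon> > 0" for \<epsilon>
      using small[OF that] by (meson trans_le_add1)
  qed
  have "(\<lambda>n. d (\<sigma> (n + k)) (\<sigma> n)) \<longlonglongrightarrow> 0"
  proof (rule LIMSEQ_I)
    fix \<epsilon> :: real assume "0 < \<epsilon>"
    from small[OF this] show "\<exists>n0. \<forall>n\<ge>n0. norm (d (\<sigma> (n + k)) (\<sigma> n) - 0) < \<epsilon>"
      using nonneg by (simp add: abs_of_nonneg) (meson trans_le_add1)
  qed
  then show "cls (\<lambda>n. \<sigma> (n + k)) = cls \<sigma>"
    using cls_eq_iff[OF C assms] by simp
qed

lemma completion_set_iff: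
  "X \<in> completion_set S d \<longleftrightarrow> (\<exists>\<sigma>. pm_Cauchy S d \<sigma> \<and> X = cls \<sigma>)"
  by (auto simp: completion_set_def quotient_def cauchy_class_def)

lemma cls_in_completion_set: "pm_Cauchy S d \<sigma> \<Longrightarrow> cls \<sigma> \<in> completion_set S d"
  by (auto simp: completion_set_iff)

text \<open>
  Operations on classes are defined as unions over all representatives; this evaluates such a union on
  one representative.
\<close>

lemma UN_cls:
  assumes "pm_Cauchy S d \<sigma>" and "\<And>\<tau>. pm_Cauchy S d \<tau> \<Longrightarrow> cls \<tau> = cls \<sigma> \<Longrightarrow> f \<tau> = f \<sigma>"
  shows "(\<Union>\<tau>\<in>cls \<sigma>. f \<tau>) = f \<sigma>"
proof -
  have "f ` cls \<sigma> = {f \<sigma>}"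
  proof (intro equalityI subsetI)
    fix y assume "y \<in> f ` cls \<sigma>"
    then obtain \<tau> where "y = f \<tau>" "\<tau> \<in> cls \<sigma>" by blast
    then show "y \<in> {f \<sigma>}"
      using assms(2)[of \<tau>] mem_cls_iff[OF assms(1)] by simp
  qed (use mem_cls_iff[OF assms(1)] assms(1) in simp)
  then show ?thesis by simp
qed

lemma Cauchy_dist_convergent:
  assumes "pm_Cauchy S d \<sigma>" "pm_Cauchy S d \<tau>"
  shows "convergent (\<lambda>n. d (\<sigma> n) (\<tau> n))"
proof -
  have "\<exists>n0. \<forall>m\<ge>n0. \<forall>n\<ge>n0. \<bar>d (\<sigma> m) (\<tau> m) - d (\<sigma> n) (\<tau> n)\<bar> < e" if "e > 0" for e
  proof -
    obtain n1 where n1: "\<And>m n. m \<ge> n1 \<Longrightarrow> n \<ge> n1 \<Longrightarrow> d (\<sigma> m) (\<sigma> n) < e/2"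
      using assms(1) \<open>e > 0\<close> unfolding pm_Cauchy_def by (meson half_gt_zero)
    obtain n2 where n2: "\<And>m n. m \<ge> n2 \<Longrightarrow> n \<ge> n2 \<Longrightarrow> d (\<tau> m) (\<tau> n) < e/2"
      using assms(2) \<open>e > 0\<close> unfolding pm_Cauchy_def by (meson half_gt_zero)
    have "\<bar>d (\<sigma> m) (\<tau> m) - d (\<sigma> n) (\<tau> n)\<bar> < e" if "m \<ge> max n1 n2" "n \<ge> max n1 n2" for m n
      using triangle_diff[of "\<sigma> m" "\<tau> m" "\<sigma> n" "\<tau> n"] n1[of m n] n2[of m n] that assms
      by (auto simp: CauchyD)
    then show ?thesis by blast
  qed
  then have "Cauchy (\<lambda>n. d (\<sigma> n) (\<tau> n))"
    by (intro metric_CauchyI) (simp add: dist_real_def)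
  then show ?thesis
    by (rule Cauchy_convergent)
qed

lemma tendsto_completion_dist:
  assumes "pm_Cauchy S d \<sigma>" "pm_Cauchy S d \<tau>"
  shows "(\<lambda>n. d (\<sigma> n) (\<tau> n)) \<longlonglongrightarrow> completion_dist S d (cls \<sigma>) (cls \<tau>)"
proof -
  let ?l = "\<lambda>\<sigma> \<tau>. lim (\<lambda>n. d (\<sigma> n) (\<tau> n))"
  have eq: "?l \<sigma>' \<tau>' = ?l \<sigma> \<tau>"
    if c: "pm_Cauchy S d \<sigma>" "pm_Cauchy S d \<tau>" "pm_Cauchy S d \<sigma>'" "pm_Cauchy S d \<tau>'"
      and e: "cls \<sigma>' = cls \<sigma>" "cls \<tau>' = cls \<tau>" for \<sigma> \<tau> \<sigma>' \<tau>'
  proof -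
    have "(\<lambda>n. d (\<sigma>' n) (\<sigma> n) + d (\<tau>' n) (\<tau> n)) \<longlonglongrightarrow> 0 + 0"
      by (intro tendsto_add cls_eq_iff[THEN iffD1] c e)
    then have "(\<lambda>n. d (\<sigma>' n) (\<tau>' n) - d (\<sigma> n) (\<tau> n)) \<longlonglongrightarrow> 0"
      unfolding add_0_left
      by (rule Lim_null_comparison[rotated]) (simp add: triangle_diff c[THEN CauchyD])
    from tendsto_add[OF this Cauchy_dist_convergent[OF c(1,2), unfolded convergent_LIMSEQ_iff]]
    show ?thesis
      by (intro limI) (simp only: diff_add_cancel add_0_left)
  qed
  have "(\<Union>\<sigma>'\<in>cls \<sigma>. \<Union>\<tau>'\<in>cls \<tau>. {?l \<sigma>' \<tau>'}) = (\<Union>\<tau>'\<in>cls \<tau>. {?l \<sigma> \<tau>'})"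
  proof (rule UN_cls[OF assms(1)])
    show "(\<Union>\<tau>'\<in>cls \<tau>. {?l \<sigma>' \<tau>'}) = (\<Union>\<tau>'\<in>cls \<tau>. {?l \<sigma> \<tau>'})"
      if "pm_Cauchy S d \<sigma>'" "cls \<sigma>' = cls \<sigma>" for \<sigma>'
      using eq[OF assms(1) _ that(1) _ that(2) HOL.refl] assms(2)
      by (intro SUP_cong HOL.refl) (simp add: mem_cls_iff)
  qed
  also have "\<dots> = {?l \<sigma> \<tau>}"
    using assms eq[OF assms(1) assms(2) assms(1)] by (intro UN_cls) blast+
  finally have "completion_dist S d (cls \<sigma>) (cls \<tau>) = ?l \<sigma> \<tau>"
    using assms by (simp add: completion_dist_def cls_in_completion_set)
  then show ?thesis
    using Cauchy_dist_convergent[OF assms] by (simp add: convergent_LIMSEQ_iff)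
qed

lemma Metric_space_completion: "Metric_space (completion_set S d) (completion_dist S d)"
proof
  let ?C = "completion_set S d" and ?D = "completion_dist S d"
  have nn: "0 \<le> ?D X Y" if XY: "X \<in> ?C" "Y \<in> ?C" for X Y
  proof -
    obtain \<sigma> \<tau> where "pm_Cauchy S d \<sigma>" "pm_Cauchy S d \<tau>" and "X = cls \<sigma>" "Y = cls \<tau>"
      using XY by (auto simp: completion_set_iff)
    then show ?thesis
      using tendsto_completion_dist[of \<sigma> \<tau>] by (auto intro: LIMSEQ_le_const simp: nonneg)
  qed
  show "0 \<le> ?D X Y" for X Y
    using nn[of X Y] by (cases "X \<in> ?C \<and> Y \<in> ?C") (auto simp: completion_dist_def)
  have co: "?D X Y = ?D Y X" if XY: "X \<in> ?C" "Y \<in> ?C" for X Y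
  proof -
    obtain \<sigma> \<tau> where st: "pm_Cauchy S d \<sigma>" "pm_Cauchy S d \<tau>" and "X = cls \<sigma>" "Y = cls \<tau>"
      using XY by (auto simp: completion_set_iff)
    then show ?thesis
      using LIMSEQ_unique[OF tendsto_completion_dist[OF st] tendsto_completion_dist[OF st(2,1),
            unfolded commute[of "\<tau> _"]]] by simp
  qed
  show "?D X Y = ?D Y X" for X Y
    using co[of X Y] by (cases "X \<in> ?C \<and> Y \<in> ?C") (auto simp: completion_dist_def)
  show "?D X Y = 0 \<longleftrightarrow> X = Y" if XY: "X \<in> ?C" "Y \<in> ?C" for X Y
  proof -
    obtain \<sigma> \<tau> where st: "pm_Cauchy S d \<sigma>" "pm_Cauchy S d \<tau>" and "X = cls \<sigma>" "Y = cls \<tau>"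
      using XY by (auto simp: completion_set_iff)
    then show ?thesis
      using tendsto_completion_dist[OF st] cls_eq_iff[OF st] by (auto intro: LIMSEQ_unique)
  qed
  show "?D X Z \<le> ?D X Y + ?D Y Z" if XYZ: "X \<in> ?C" "Y \<in> ?C" "Z \<in> ?C" for X Y Z
  proof -
    obtain \<sigma> \<tau> \<upsilon> where st: "pm_Cauchy S d \<sigma>" "pm_Cauchy S d \<tau>" "pm_Cauchy S d \<upsilon>"
      and "X = cls \<sigma>" "Y = cls \<tau>" "Z = cls \<upsilon>"
      using XYZ by (auto simp: completion_set_iff)
    moreover have "?D (cls \<sigma>) (cls \<upsilon>) \<le> ?D (cls \<sigma>) (cls \<tau>) + ?D (cls \<tau>) (cls \<upsilon>)"
      by (rule LIMSEQ_le[OF tendsto_completion_dist tendsto_add[OF tendsto_completion_dist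
            tendsto_completion_dist]])
        (simp_all add: st triangle CauchyD)
    ultimately show ?thesis by simp
  qed
qed

sublocale completion: Metric_space "completion_set S d" "completion_dist S d"
  by (rule Metric_space_completion)

lemma completion_map_in: "x \<in> S \<Longrightarrow> completion_map S d x \<in> completion_set S d"
  by (simp add: completion_map_def cls_in_completion_set Cauchy_const)

lemma completion_map_isometric:
  assumes "x \<in> S" "y \<in> S"
  shows "completion_dist S d (completion_map S d x) (completion_map S d y) = d x y"
  unfolding completion_map_def
  using LIMSEQ_unique[OF tendsto_const tendsto_completion_dist[OF assms[THEN Cauchy_const]]] by simp

text \<open>
  A Cauchy sequence of points converges, in the completion, to its own class; in particular the image
  of the space is dense.
\<close>

lemma completion_map_tendsto_cls:
  assumes "pm_Cauchy S d \<sigma>"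
  shows "(\<lambda>n. completion_dist S d (completion_map S d (\<sigma> n)) (cls \<sigma>)) \<longlonglongrightarrow> 0"
proof (rule LIMSEQ_I)
  fix e :: real assume "0 < e"
  then obtain n0 where n0: "\<And>m n. m \<ge> n0 \<Longrightarrow> n \<ge> n0 \<Longrightarrow> d (\<sigma> m) (\<sigma> n) < e/2"
    using assms unfolding pm_Cauchy_def by (meson half_gt_zero)
  have "completion_dist S d (completion_map S d (\<sigma> n)) (cls \<sigma>) \<le> e/2" if "n \<ge> n0" for n
  proof (rule LIMSEQ_le_const2)
    show "(\<lambda>m. d (\<sigma> n) (\<sigma> m)) \<longlonglongrightarrow> completion_dist S d (completion_map S d (\<sigma> n)) (cls \<sigma>)"
      unfolding completion_map_def
      using assms by (intro tendsto_completion_dist Cauchy_const) (auto simp: CauchyD)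
    show "\<exists>N. \<forall>m\<ge>N. d (\<sigma> n) (\<sigma> m) \<le> e/2"
      using n0 that by (meson less_imp_le)
  qed
  then have "norm (completion_dist S d (completion_map S d (\<sigma> n)) (cls \<sigma>) - 0) < e" if "n \<ge> n0" for n
    using \<open>0 < e\<close> that completion.nonneg by (simp add: abs_of_nonneg le_less_trans[where y = "e/2"])
  then show "\<exists>n0. \<forall>n\<ge>n0. norm (completion_dist S d (completion_map S d (\<sigma> n)) (cls \<sigma>) - 0) < e"
    by blast
qed

text \<open>
  A Cauchy sequence in the completion can be replaced, term by term, by elements of \<open>S\<close> at distance
  tending to \<open>0\<close>; their classes then give its limit.
\<close>

lemma tendsto_cls_of_approximation:
  assumes X: "pm_Cauchy (completion_set S d) (completion_dist S d) X" and a: "range a \<subseteq> S"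
    and aX: "(\<lambda>n. completion_dist S d (completion_map S d (a n)) (X n)) \<longlonglongrightarrow> 0"
  shows "pm_Cauchy S d a" and "(\<lambda>n. completion_dist S d (X n) (cls a)) \<longlonglongrightarrow> 0"
proof -
  let ?D = "completion_dist S d" and ?\<iota> = "completion_map S d"
  have aS: "a n \<in> S" for n using a by auto
  have XC: "X n \<in> completion_set S d" for n using X by (auto simp: pm_Cauchy_def)
  have "\<exists>n0. \<forall>m\<ge>n0. \<forall>n\<ge>n0. d (a m) (a n) < e" if "e > 0" for e
  proof -
    have e3: "e/3 > 0" using that by simp
    obtain n1 where n1: "\<And>m n. m \<ge> n1 \<Longrightarrow> n \<ge> n1 \<Longrightarrow> ?D (X m) (X n) < e/3"
      using X e3 unfolding pm_Cauchy_def by meson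
    obtain n2 where n2: "\<And>n. n \<ge> n2 \<Longrightarrow> ?D (?\<iota> (a n)) (X n) < e/3"
      using order_tendstoD(2)[OF aX e3] by (auto simp: eventually_sequentially)
    have "d (a m) (a n) < e" if "m \<ge> max n1 n2" "n \<ge> max n1 n2" for m n
    proof -
      have "d (a m) (a n) = ?D (?\<iota> (a m)) (?\<iota> (a n))"
        by (simp add: completion_map_isometric aS)
      also have "\<dots> \<le> ?D (?\<iota> (a m)) (X m) + ?D (X m) (?\<iota> (a n))"
        by (intro completion.triangle completion_map_in aS XC)
      also have "\<dots> \<le> ?D (?\<iota> (a m)) (X m) + (?D (X m) (X n) + ?D (X n) (?\<iota> (a n)))"
        by (intro add_left_mono completion.triangle completion_map_in aS XC)
      also have "\<dots> < e"
        using n1[of m n] n2[of m] n2[of n] that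
        by (simp add: completion.commute[of "X n" "?\<iota> (a n)"])
      finally show ?thesis .
    qed
    then show ?thesis by blast
  qed
  then show C: "pm_Cauchy S d a"
    using a by (simp add: pm_Cauchy_def)
  have "(\<lambda>n. ?D (?\<iota> (a n)) (X n) + ?D (?\<iota> (a n)) (cls a)) \<longlonglongrightarrow> 0 + 0"
    by (intro tendsto_add aX completion_map_tendsto_cls C)
  then show "(\<lambda>n. ?D (X n) (cls a)) \<longlonglongrightarrow> 0"
    by (intro null_squeeze[OF _ completion.nonneg completion.triangle''])
      (auto intro: completion_map_in aS XC cls_in_completion_set C)
qed

text \<open>
  For a point of the closure, choose elements of \<open>A\<close> closer and closer to it: they form a Cauchy
  sequence, and its class is the point. Conversely a class is the limit of the terms of its
  representatives.
\<close>

lemma mem_closure_of_image_iff: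
  assumes "A \<subseteq> S"
  shows "X \<in> completion_topology S d closure_of (completion_map S d ` A) \<longleftrightarrow>
    (\<exists>\<sigma>. pm_Cauchy S d \<sigma> \<and> range \<sigma> \<subseteq> A \<and> X = cls \<sigma>)"
proof -
  let ?D = "completion_dist S d" and ?\<iota> = "completion_map S d"
  have clo: "X \<in> completion_topology S d closure_of (?\<iota> ` A) \<longleftrightarrow>
    X \<in> completion_set S d \<and> (\<forall>r>0. \<exists>a\<in>A. ?D X (?\<iota> a) < r)"
  proof -
    have "?\<iota> a \<in> completion_set S d" if "a \<in> A" for a
      using that assms completion_map_in by blast
    then show ?thesis
      unfolding completion_topology_def pm_topology_eq_mtopology[OF Metric_space_completion]
        completion.metric_closure_of
      by (simp add: completion.in_mball cong: conj_cong bex_cong)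
  qed
  show ?thesis
  proof
    assume h: "X \<in> completion_topology S d closure_of (?\<iota> ` A)"
    then have "\<exists>a\<in>A. ?D X (?\<iota> a) < inverse (real (Suc n))" for n
      using clo by simp
    then obtain a where a: "\<And>n. a n \<in> A" "\<And>n. ?D X (?\<iota> (a n)) < inverse (real (Suc n))"
      by metis
    have X: "X \<in> completion_set S d"
      using h clo by blast
    have "(\<lambda>n. ?D (?\<iota> (a n)) X) \<longlonglongrightarrow> 0"
      by (rule null_squeeze[OF LIMSEQ_inverse_real_of_nat completion.nonneg])
        (use a(2) in \<open>simp add: completion.commute[of _ X] less_imp_le\<close>)
    moreover have "pm_Cauchy (completion_set S d) ?D (\<lambda>n. X)"
      using X by (auto simp: pm_Cauchy_def)
    moreover have "range a \<subseteq> S"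
      using a(1) assms by auto
    ultimately have "pm_Cauchy S d a" "(\<lambda>n. ?D X (cls a)) \<longlonglongrightarrow> 0"
      using tendsto_cls_of_approximation[of "\<lambda>n. X" a] by simp_all
    moreover from this have "X = cls a"
      using X cls_in_completion_set by (auto simp: LIMSEQ_const_iff)
    ultimately show "\<exists>\<sigma>. pm_Cauchy S d \<sigma> \<and> range \<sigma> \<subseteq> A \<and> X = cls \<sigma>"
      using a(1) by blast
  next
    assume "\<exists>\<sigma>. pm_Cauchy S d \<sigma> \<and> range \<sigma> \<subseteq> A \<and> X = cls \<sigma>"
    then obtain \<sigma> where s: "pm_Cauchy S d \<sigma>" "range \<sigma> \<subseteq> A" "X = cls \<sigma>" by blast
    have "\<exists>a\<in>A. ?D X (?\<iota> a) < r" if "r > 0" for r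
    proof -
      have "\<exists>n. ?D (?\<iota> (\<sigma> n)) X < r"
        using order_tendstoD(2)[OF completion_map_tendsto_cls[OF s(1)] that] s(3)
        by (auto simp: eventually_sequentially)
      then show ?thesis
        using s(2) completion.commute by (metis range_subsetD)
    qed
    then show "X \<in> completion_topology S d closure_of (?\<iota> ` A)"
      using s clo cls_in_completion_set by auto
  qed
qed

text \<open>
  Given a Cauchy sequence in the closure, approximate its \<open>n\<close>-th term up to \<open>1 / (n + 1)\<close> by an element
  of \<open>A\<close>. The class of the approximating sequence is the limit, and it lies in the closure because its
  representative lies in \<open>A\<close>.
\<close>

lemma hausdorff_complete_closure_of_image:
  assumes "A \<subseteq> S"
  shows "hausdorff_complete (completion_topology S d closure_of (completion_map S d ` A))
    (completion_dist S d)"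
    (is "hausdorff_complete ?A ?D")
proof -
  let ?\<iota> = "completion_map S d"
  have sub: "?A \<subseteq> completion_set S d"
    using mem_closure_of_image_iff[OF assms] cls_in_completion_set by auto
  have MA: "Metric_space ?A ?D"
    using completion.subspace[OF sub] .
  then interpret A: Metric_space ?A ?D .
  interpret PA: pseudo_metric ?A ?D
    by (intro pseudo_metric.intro A.nonneg A.commute A.triangle) simp_all
  have "\<exists>Y. limitin (pm_topology ?A ?D) X Y sequentially" if X: "pm_Cauchy ?A ?D X" for X
  proof -
    have XA: "X n \<in> ?A" for n using X by (auto simp: pm_Cauchy_def)
    have XC: "pm_Cauchy (completion_set S d) ?D X"
      using X sub by (auto simp: pm_Cauchy_def)
    have "\<exists>a\<in>A. ?D (?\<iota> a) (X n) < inverse (real (Suc n))" for n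
    proof -
      obtain \<sigma> where s: "pm_Cauchy S d \<sigma>" "range \<sigma> \<subseteq> A" "X n = cls \<sigma>"
        using XA mem_closure_of_image_iff[OF assms] by blast
      have "0 < inverse (real (Suc n))" by simp
      from order_tendstoD(2)[OF completion_map_tendsto_cls[OF s(1)] this]
      have "\<exists>k. ?D (?\<iota> (\<sigma> k)) (X n) < inverse (real (Suc n))"
        using s(3) by (auto simp: eventually_sequentially)
      then show ?thesis using s(2) by auto
    qed
    then obtain a where a: "\<And>n. a n \<in> A" "\<And>n. ?D (?\<iota> (a n)) (X n) < inverse (real (Suc n))"
      by metis
    have "(\<lambda>n. ?D (?\<iota> (a n)) (X n)) \<longlonglongrightarrow> 0"
      by (rule null_squeeze[OF LIMSEQ_inverse_real_of_nat completion.nonneg])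
        (use a(2) in \<open>simp add: less_imp_le\<close>)
    then have "pm_Cauchy S d a" "(\<lambda>n. ?D (X n) (cls a)) \<longlonglongrightarrow> 0"
      using tendsto_cls_of_approximation[OF XC, of a] a(1) assms by auto
    moreover from this have "cls a \<in> ?A"
      using mem_closure_of_image_iff[OF assms] a(1) by blast
    moreover have "range X \<subseteq> ?A" using XA by blast
    ultimately show ?thesis
      using PA.limitin_pm_topology by blast
  qed
  then show ?thesis
    using A.Hausdorff_space_mtopology
    by (simp add: hausdorff_complete_def pm_complete_def pm_topology_eq_mtopology[OF MA])
qed

end

section \<open>Cones and ordered vector spaces\<close>

lemma (in abelian_group) a_inv_zero: "\<ominus> \<zero> = \<zero>"
  by (rule minus_equality) simp_all

text \<open>
  With these rules the \<open>algebra\<close> method decides linear identities in abelian groups.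
\<close>

lemmas (in abelian_group) abelian_group_simprules
  [algebra abelian_group "zero G" "add G" "a_inv G" "a_minus G"] =
  a_closed zero_closed a_inv_closed minus_closed a_assoc l_zero l_neg a_comm minus_eq r_zero
  r_neg r_neg2 r_neg1 minus_add minus_minus a_inv_zero a_lcomm

lemma scalar_field_simps [simp]:
  "carrier (scalar_field K) = K" "x \<otimes>\<^bsub>scalar_field K\<^esub> y = x * y" "\<one>\<^bsub>scalar_field K\<^esub> = 1"
  "\<zero>\<^bsub>scalar_field K\<^esub> = 0" "x \<oplus>\<^bsub>scalar_field K\<^esub> y = x + y"
  by (simp_all add: scalar_field_def)

text \<open>
  The vector spaces that occur are of two record types, with and without an order, so the consequences
  of the module laws are collected without reference to the order.
\<close>

locale real_module = module "scalar_field K" M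
  for K and M :: "(real, 'a, 'z) module_scheme" (structure)
begin

lemma scalar_closed:
  "0 \<in> K" "1 \<in> K" "\<lbrakk>a \<in> K; c \<in> K\<rbrakk> \<Longrightarrow> a + c \<in> K" "\<lbrakk>a \<in> K; c \<in> K\<rbrakk> \<Longrightarrow> a * c \<in> K"
  using R.zero_closed R.one_closed R.a_closed[of a c] R.m_closed[of a c] by simp_all

lemma scalar_uminus:
  assumes "a \<in> K"
  shows "\<ominus>\<^bsub>scalar_field K\<^esub> a = - a" and "- a \<in> K"
proof -
  have "a + \<ominus>\<^bsub>scalar_field K\<^esub> a = 0"
    using R.r_neg[of a] assms by simp
  then show eq: "\<ominus>\<^bsub>scalar_field K\<^esub> a = - a" by linarith
  show "- a \<in> K"
    using R.a_inv_closed[of a] assms by (simp add: eq)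
qed

lemma scalar_abs: "a \<in> K \<Longrightarrow> \<bar>a\<bar> \<in> K"
  by (simp add: abs_if scalar_uminus)

lemma smult_uminus: "\<lbrakk>a \<in> K; x \<in> carrier M\<rbrakk> \<Longrightarrow> (- a) \<odot>\<^bsub>M\<^esub> x = \<ominus> (a \<odot>\<^bsub>M\<^esub> x)"
  using smult_l_minus[of a x] by (simp add: scalar_uminus)

lemma smult_add_left: "\<lbrakk>a \<in> K; c \<in> K; x \<in> carrier M\<rbrakk> \<Longrightarrow> (a + c) \<odot>\<^bsub>M\<^esub> x = a \<odot>\<^bsub>M\<^esub> x \<oplus> c \<odot>\<^bsub>M\<^esub> x"
  using smult_l_distr[of a c x] by simp

lemma smult_add_right:
  "\<lbrakk>a \<in> K; x \<in> carrier M; y \<in> carrier M\<rbrakk> \<Longrightarrow> a \<odot>\<^bsub>M\<^esub> (x \<oplus> y) = a \<odot>\<^bsub>M\<^esub> x \<oplus> a \<odot>\<^bsub>M\<^esub> y"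
  using smult_r_distr[of a x y] by simp

lemma smult_diff_right:
  "\<lbrakk>a \<in> K; x \<in> carrier M; y \<in> carrier M\<rbrakk> \<Longrightarrow> a \<odot>\<^bsub>M\<^esub> (x \<ominus> y) = a \<odot>\<^bsub>M\<^esub> x \<ominus> a \<odot>\<^bsub>M\<^esub> y"
  by (simp add: M.minus_eq smult_add_right smult_r_minus)

lemma smult_smult: "\<lbrakk>a \<in> K; c \<in> K; x \<in> carrier M\<rbrakk> \<Longrightarrow> a \<odot>\<^bsub>M\<^esub> (c \<odot>\<^bsub>M\<^esub> x) = (a * c) \<odot>\<^bsub>M\<^esub> x"
  using smult_assoc1[of a c x] by simp

lemma smult_zero_one:
  "x \<in> carrier M \<Longrightarrow> 0 \<odot>\<^bsub>M\<^esub> x = \<zero>" "x \<in> carrier M \<Longrightarrow> 1 \<odot>\<^bsub>M\<^esub> x = x"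
  using smult_l_null[of x] smult_one[of x] by simp_all

text \<open>
  A negative scalar exchanges the two members of a difference.
\<close>

lemma submodule_differences:
  assumes N: "is_cone K M N" and ne: "N \<noteq> {}"
  shows "submodule (differences M N) (scalar_field K) M"
proof -
  have sub: "\<And>x. x \<in> N \<Longrightarrow> x \<in> carrier M"
    and add: "\<And>x y. x \<in> N \<Longrightarrow> y \<in> N \<Longrightarrow> x \<oplus> y \<in> N"
    and scale: "\<And>a x. a \<in> K \<Longrightarrow> 0 \<le> a \<Longrightarrow> x \<in> N \<Longrightarrow> a \<odot>\<^bsub>M\<^esub> x \<in> N"
    using N by (auto simp: is_cone_def)
  have diffI: "z \<in> differences M N" if "z = x \<ominus> y" "x \<in> N" "y \<in> N" for x y z
    using that by (auto simp: differences_def)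
  show ?thesis
  proof (rule submoduleI)
    show "differences M N \<subseteq> carrier M"
      using sub by (auto simp: differences_def)
    obtain x where "x \<in> N" using ne by blast
    then show "\<zero> \<in> differences M N"
      using sub by (intro diffI[of _ x x]) (simp_all add: M.minus_eq M.r_neg)
  next
    fix z assume "z \<in> differences M N"
    then obtain x y where z: "z = x \<ominus> y" and xy: "x \<in> N" "y \<in> N" by (auto simp: differences_def)
    note c = xy[THEN sub]
    have "\<ominus> z = y \<ominus> x" unfolding z using c by algebra
    then show "\<ominus> z \<in> differences M N" using xy by (intro diffI)
    fix a assume "a \<in> carrier (scalar_field K)"
    then have a: "a \<in> K" by simp
    show "a \<odot>\<^bsub>M\<^esub> z \<in> differences M N"
    proof (cases "0 \<le> a")
      case True
      then show ?thesis
        using a xy c by (intro diffI[of _ "a \<odot>\<^bsub>M\<^esub> x" "a \<odot>\<^bsub>M\<^esub> y"]) (simp_all add: z scale smult_diff_right)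
    next
      case False
      have "a \<odot>\<^bsub>M\<^esub> z = \<ominus> ((- a) \<odot>\<^bsub>M\<^esub> z)"
        using a c by (simp add: z smult_uminus)
      also have "\<dots> = (- a) \<odot>\<^bsub>M\<^esub> y \<ominus> (- a) \<odot>\<^bsub>M\<^esub> x"
      proof -
        have "(- a) \<odot>\<^bsub>M\<^esub> x \<in> carrier M" "(- a) \<odot>\<^bsub>M\<^esub> y \<in> carrier M"
          using a c by (simp_all add: scalar_uminus)
        then show ?thesis
          unfolding z smult_diff_right[OF scalar_uminus(2)[OF a] c] by algebra
      qed
      finally show ?thesis
        using False a xy by (intro diffI[OF _ scale[of "- a" y] scale[of "- a" x]]) (simp_all add: scalar_uminus)
    qed
  next
    fix z w assume "z \<in> differences M N" "w \<in> differences M N"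
    then obtain x y x' y' where z: "z = x \<ominus> y" "w = x' \<ominus> y'" and xy: "x \<in> N" "y \<in> N" "x' \<in> N" "y' \<in> N"
      by (auto simp: differences_def)
    have "z \<oplus> w = (x \<oplus> x') \<ominus> (y \<oplus> y')"
      unfolding z using xy[THEN sub] by algebra
    then show "z \<oplus> w \<in> differences M N"
      using xy by (intro diffI[OF _ add add])
  qed
qed

end

sublocale ordered_vector_space \<subseteq> real_module K M
  by (rule real_module.intro) (rule module_axioms)

context ordered_vector_space
begin

abbreviation P where "P \<equiv> nonneg_part M"

lemma nonneg_part_iff: "x \<in> P \<longleftrightarrow> x \<in> carrier M \<and> \<zero> \<preceq> x"
  by (simp add: nonneg_part_def)

lemma nonneg_carrier: "x \<in> P \<Longrightarrow> x \<in> carrier M"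
  by (simp add: nonneg_part_def)

lemma le_refl: "x \<in> carrier M \<Longrightarrow> x \<preceq> x"
  using partial_order by (auto simp: partial_order_on_def preorder_on_def refl_on_def)

lemma le_trans: "\<lbrakk>x \<preceq> y; y \<preceq> z; x \<in> carrier M; y \<in> carrier M; z \<in> carrier M\<rbrakk> \<Longrightarrow> x \<preceq> z"
  using partial_order unfolding partial_order_on_def preorder_on_def trans_def by blast

lemma le_iff_diff:
  assumes "x \<in> carrier M" "y \<in> carrier M"
  shows "x \<preceq> y \<longleftrightarrow> y \<ominus> x \<in> P"
proof
  assume "x \<preceq> y"
  then have "x \<oplus> \<ominus> x \<preceq> y \<oplus> \<ominus> x"
    using assms by (intro add_mono) simp_all
  then show "y \<ominus> x \<in> P"
    using assms by (simp add: nonneg_part_iff M.minus_eq M.r_neg)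
next
  assume "y \<ominus> x \<in> P"
  then have "\<zero> \<oplus> x \<preceq> (y \<ominus> x) \<oplus> x"
    using assms by (intro add_mono) (simp_all add: nonneg_part_iff)
  moreover have "(y \<ominus> x) \<oplus> x = y" using assms by algebra
  ultimately show "x \<preceq> y" using assms by simp
qed

lemma nonneg_add: "\<lbrakk>x \<in> P; y \<in> P\<rbrakk> \<Longrightarrow> x \<oplus> y \<in> P"
  using add_mono[of \<zero> x y] le_trans[of \<zero> y "x \<oplus> y"] by (simp add: nonneg_part_iff)

lemma nonneg_smult: "\<lbrakk>a \<in> K; 0 \<le> a; x \<in> P\<rbrakk> \<Longrightarrow> a \<odot>\<^bsub>M\<^esub> x \<in> P"
  using smult_mono[of a \<zero> x] smult_r_null[of a] by (simp add: nonneg_part_iff)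

lemma zero_nonneg: "\<zero> \<in> P"
  by (simp add: nonneg_part_iff le_refl)

lemma is_cone_nonneg_part: "is_cone K M P"
  by (auto simp: is_cone_def nonneg_add nonneg_smult nonneg_carrier)

end

text \<open>
  Pointed cones and vector space orders determine each other; antisymmetry of the order is the
  condition that the cone is pointed.
\<close>

lemma ordered_vector_space_of_cone:
  fixes M :: "(real, 'a) ordered_module" (structure)
  assumes "module (scalar_field K) M" and P: "is_cone K M P" "\<zero> \<in> P"
    and pointed: "\<And>x. \<lbrakk>x \<in> P; \<ominus> x \<in> P\<rbrakk> \<Longrightarrow> x = \<zero>"
    and le: "\<And>x y. \<lbrakk>x \<in> carrier M; y \<in> carrier M\<rbrakk> \<Longrightarrow> x \<preceq> y \<longleftrightarrow> y \<ominus> x \<in> P"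
  shows "ordered_vector_space K M" and "nonneg_part M = P"
proof -
  interpret real_module K M
    by (rule real_module.intro) fact
  have sub: "\<And>x. x \<in> P \<Longrightarrow> x \<in> carrier M"
    and add: "\<And>x y. x \<in> P \<Longrightarrow> y \<in> P \<Longrightarrow> x \<oplus> y \<in> P"
    and scale: "\<And>a x. a \<in> K \<Longrightarrow> 0 \<le> a \<Longrightarrow> x \<in> P \<Longrightarrow> a \<odot>\<^bsub>M\<^esub> x \<in> P"
    using P by (auto simp: is_cone_def)
  show "ordered_vector_space K M"
  proof
    let ?r = "{(x, y). x \<in> carrier M \<and> y \<in> carrier M \<and> x \<preceq> y}"
    have "refl_on (carrier M) ?r"
      by (auto simp: refl_on_def le M.minus_eq M.r_neg P(2))
    moreover have "trans ?r"
    proof (unfold trans_def, clarify)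
      fix x y z assume c: "x \<in> carrier M" "y \<in> carrier M" "z \<in> carrier M" and "x \<preceq> y" "y \<preceq> z"
      then have "(z \<ominus> y) \<oplus> (y \<ominus> x) \<in> P" by (simp add: le add)
      moreover have "(z \<ominus> y) \<oplus> (y \<ominus> x) = z \<ominus> x" using c by algebra
      ultimately show "x \<preceq> z" using c by (simp add: le)
    qed
    moreover have "antisym ?r"
    proof (rule antisymI, clarify)
      fix x y assume c: "x \<in> carrier M" "y \<in> carrier M" and "x \<preceq> y" "y \<preceq> x"
      then have "y \<ominus> x \<in> P" "x \<ominus> y \<in> P" by (simp_all add: le)
      moreover have "x \<ominus> y = \<ominus> (y \<ominus> x)" using c by algebra
      ultimately have 0: "y \<ominus> x = \<zero>" using pointed by simp
      have "x = (y \<ominus> x) \<oplus> x" using c by (simp add: 0)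
      also have "\<dots> = y" using c by algebra
      finally show "x = y" .
    qed
    ultimately show "partial_order_on (carrier M) ?r"
      by (auto simp: partial_order_on_def preorder_on_def)
  next
    fix x y z assume c: "x \<in> carrier M" "y \<in> carrier M" "z \<in> carrier M" and "x \<preceq> y"
    then have "y \<ominus> x \<in> P" by (simp add: le)
    moreover have "y \<ominus> x = (y \<oplus> z) \<ominus> (x \<oplus> z)" using c by algebra
    ultimately show "x \<oplus> z \<preceq> y \<oplus> z" using c by (simp add: le)
  next
    fix a x y assume c: "a \<in> K" "0 \<le> a" "x \<in> carrier M" "y \<in> carrier M" and "x \<preceq> y"
    then have "a \<odot>\<^bsub>M\<^esub> (y \<ominus> x) \<in> P" by (simp add: le scale)
    then show "a \<odot>\<^bsub>M\<^esub> x \<preceq> a \<odot>\<^bsub>M\<^esub> y" using c by (simp add: le smult_diff_right)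
  qed
  show "nonneg_part M = P"
  proof -
    have "x \<ominus> \<zero> = x" if "x \<in> carrier M" for x using that by algebra
    then show ?thesis
      using sub by (auto simp: nonneg_part_def le)
  qed
qed

section \<open>The b-topology\<close>

locale b_topology = ordered_vector_space K M
  for K and M :: "(real, 'a) ordered_module" (structure) +
  fixes b
  assumes field: "K = \<rat> \<or> K = \<real>" and b_nonneg: "b \<in> nonneg_part M"
begin

abbreviation dist where "dist \<equiv> b_dist K M b"

text \<open>
  This says \<open>- \<delta> b \<le> z \<le> \<delta> b\<close> (see \<open>bounded_by_iff_le\<close>), written with the nonnegative cone so that
  sums and limits of such bounds reduce to the cone being closed under them.
\<close>

definition bounded_by where
  "bounded_by \<delta> z \<longleftrightarrow> z \<in> carrier M \<and> \<delta> \<odot>\<^bsub>M\<^esub> b \<ominus> z \<in> P \<and> \<delta> \<odot>\<^bsub>M\<^esub> b \<oplus> z \<in> P"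

lemma b_carrier: "b \<in> carrier M"
  using b_nonneg nonneg_carrier by blast

lemma smult_b_carrier: "a \<in> K \<Longrightarrow> a \<odot>\<^bsub>M\<^esub> b \<in> carrier M"
  using b_carrier by simp

lemma scalar_dense: "x < y \<Longrightarrow> \<exists>a\<in>K. x < a \<and> a < y"
  using field Rats_dense_in_real[of x y] dense[of x y] by (auto simp: Reals_def)

lemma bounded_by_add:
  assumes "\<delta> \<in> K" "\<epsilon> \<in> K" "bounded_by \<delta> x" "bounded_by \<epsilon> y"
  shows "bounded_by (\<delta> + \<epsilon>) (x \<oplus> y)"
proof -
  have c: "x \<in> carrier M" "y \<in> carrier M" "\<delta> \<odot>\<^bsub>M\<^esub> b \<in> carrier M" "\<epsilon> \<odot>\<^bsub>M\<^esub> b \<in> carrier M"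
    using assms smult_b_carrier by (auto simp: bounded_by_def)
  have "(\<delta> \<odot>\<^bsub>M\<^esub> b \<oplus> \<epsilon> \<odot>\<^bsub>M\<^esub> b) \<ominus> (x \<oplus> y) = (\<delta> \<odot>\<^bsub>M\<^esub> b \<ominus> x) \<oplus> (\<epsilon> \<odot>\<^bsub>M\<^esub> b \<ominus> y)"
    "(\<delta> \<odot>\<^bsub>M\<^esub> b \<oplus> \<epsilon> \<odot>\<^bsub>M\<^esub> b) \<oplus> (x \<oplus> y) = (\<delta> \<odot>\<^bsub>M\<^esub> b \<oplus> x) \<oplus> (\<epsilon> \<odot>\<^bsub>M\<^esub> b \<oplus> y)"
    using c by algebra+
  then show ?thesis
    using assms c b_carrier by (simp add: bounded_by_def smult_add_left nonneg_add)
qed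

lemma bounded_by_uminus: "bounded_by \<delta> z \<Longrightarrow> \<delta> \<in> K \<Longrightarrow> bounded_by \<delta> (\<ominus> z)"
  using smult_b_carrier[of \<delta>] by (auto simp: bounded_by_def M.minus_eq)

lemma bounded_by_smult:
  assumes "\<delta> \<in> K" "a \<in> K" "bounded_by \<delta> z"
  shows "bounded_by (\<bar>a\<bar> * \<delta>) (a \<odot>\<^bsub>M\<^esub> z)"
proof -
  have pos: "bounded_by (a * \<delta>) (a \<odot>\<^bsub>M\<^esub> z)" if "a \<in> K" "0 \<le> a" for a
  proof -
    have z: "z \<in> carrier M" "\<delta> \<odot>\<^bsub>M\<^esub> b \<in> carrier M"
      using assms smult_b_carrier by (auto simp: bounded_by_def)
    have "a \<odot>\<^bsub>M\<^esub> (\<delta> \<odot>\<^bsub>M\<^esub> b \<ominus> z) \<in> P" "a \<odot>\<^bsub>M\<^esub> (\<delta> \<odot>\<^bsub>M\<^esub> b \<oplus> z) \<in> P"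
      using assms that by (auto simp: bounded_by_def nonneg_smult)
    then show ?thesis
      using z that assms b_carrier
      by (simp add: bounded_by_def smult_diff_right smult_add_right smult_smult)
  qed
  show ?thesis
  proof (cases "0 \<le> a")
    case False
    then have "bounded_by (- a * \<delta>) ((- a) \<odot>\<^bsub>M\<^esub> z)"
      using pos[of "- a"] assms by (simp add: scalar_uminus)
    then have "bounded_by (- a * \<delta>) (\<ominus> ((- a) \<odot>\<^bsub>M\<^esub> z))"
      using assms by (intro bounded_by_uminus scalar_closed scalar_uminus)
    then show ?thesis
      using False assms by (simp add: smult_uminus bounded_by_def)
  qed (use pos assms in simp)
qed

lemma bounded_by_smaller:
  assumes "\<delta> \<in> K" "0 \<le> \<delta>" and xy: "x \<in> P" "y \<in> P" and "bounded_by \<delta> (x \<oplus> y)"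
  shows "bounded_by \<delta> x"
proof -
  have c: "x \<in> carrier M" "y \<in> carrier M" "\<delta> \<odot>\<^bsub>M\<^esub> b \<in> carrier M"
    using assms nonneg_carrier smult_b_carrier by auto
  have "\<delta> \<odot>\<^bsub>M\<^esub> b \<ominus> x = (\<delta> \<odot>\<^bsub>M\<^esub> b \<ominus> (x \<oplus> y)) \<oplus> y" using c by algebra
  moreover have "\<delta> \<odot>\<^bsub>M\<^esub> b \<in> P" using assms b_nonneg nonneg_smult by simp
  ultimately show ?thesis
    using assms c by (simp add: bounded_by_def nonneg_add)
qed

lemma bounded_by_mono:
  assumes "\<delta> \<in> K" "\<epsilon> \<in> K" "\<delta> \<le> \<epsilon>" "bounded_by \<delta> z"
  shows "bounded_by \<epsilon> z"
proof -
  have K: "\<epsilon> - \<delta> \<in> K"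
    using scalar_closed(3)[OF assms(2) scalar_uminus(2)[OF assms(1)]] by simp
  have "(\<epsilon> - \<delta>) \<odot>\<^bsub>M\<^esub> b \<in> P"
    using K assms(3) b_nonneg by (intro nonneg_smult) simp_all
  moreover have "(\<epsilon> - \<delta>) \<odot>\<^bsub>M\<^esub> b \<ominus> \<zero> = (\<epsilon> - \<delta>) \<odot>\<^bsub>M\<^esub> b"
    using smult_b_carrier[OF K] by algebra
  ultimately have "bounded_by (\<epsilon> - \<delta>) \<zero>"
    using smult_b_carrier[OF K] by (simp add: bounded_by_def)
  then have "bounded_by (\<delta> + (\<epsilon> - \<delta>)) (z \<oplus> \<zero>)"
    using assms K by (intro bounded_by_add)
  then show ?thesis
    using assms(4) by (simp add: bounded_by_def)
qed

lemma bounded_by_iff_le: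
  assumes "\<delta> \<in> K" "z \<in> carrier M"
  shows "bounded_by \<delta> z \<longleftrightarrow> \<ominus> (\<delta> \<odot>\<^bsub>M\<^esub> b) \<preceq> z \<and> z \<preceq> \<delta> \<odot>\<^bsub>M\<^esub> b"
proof -
  have c: "\<delta> \<odot>\<^bsub>M\<^esub> b \<in> carrier M" using assms smult_b_carrier by simp
  have "z \<ominus> \<ominus> (\<delta> \<odot>\<^bsub>M\<^esub> b) = \<delta> \<odot>\<^bsub>M\<^esub> b \<oplus> z" using c assms(2) by algebra
  then show ?thesis
    using c assms(2) by (auto simp: bounded_by_def le_iff_diff)
qed

lemma dist_eq_Inf:
  assumes "x \<in> carrier M" "y \<in> carrier M"
  shows "ereal (dist x y) = min (Inf (ereal ` {\<delta> \<in> K. 0 \<le> \<delta> \<and> bounded_by \<delta> (x \<ominus> y)})) 1"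
proof -
  let ?I = "Inf (ereal ` {\<delta> \<in> K. 0 \<le> \<delta> \<and> bounded_by \<delta> (x \<ominus> y)})"
  have "0 \<le> ?I"
    by (rule Inf_greatest) auto
  then have "\<bar>min ?I 1\<bar> \<noteq> \<infinity>"
    by (cases ?I) (auto simp: min_def)
  moreover have "dist x y = real_of_ereal (min ?I 1)"
    using assms by (simp add: b_dist_def bounded_by_iff_le cong: conj_cong)
  ultimately show ?thesis
    by (simp add: ereal_real)
qed

lemma dist_bounds: "0 \<le> dist x y" "dist x y \<le> 1"
proof -
  have "0 \<le> dist x y \<and> dist x y \<le> 1"
  proof (cases "x \<in> carrier M \<and> y \<in> carrier M")
    case True
    have "0 \<le> Inf (ereal ` {\<delta> \<in> K. 0 \<le> \<delta> \<and> bounded_by \<delta> (x \<ominus> y)})"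
      by (rule Inf_greatest) auto
    then have "0 \<le> ereal (dist x y)" "ereal (dist x y) \<le> 1"
      using True by (simp_all add: dist_eq_Inf)
    then show ?thesis by simp
  qed (auto simp: b_dist_def)
  then show "0 \<le> dist x y" "dist x y \<le> 1" by auto
qed

text \<open>
  Since \<open>d\<^sub>b\<close> is truncated at \<open>1\<close>, it carries information about the order only through thresholds
  \<open>\<epsilon> \<le> 1\<close>. All metric estimates below go through this equivalence.
\<close>

lemma dist_less_iff:
  assumes "x \<in> carrier M" "y \<in> carrier M" "\<epsilon> \<le> 1"
  shows "dist x y < \<epsilon> \<longleftrightarrow> (\<exists>\<delta>\<in>K. 0 \<le> \<delta> \<and> \<delta> < \<epsilon> \<and> bounded_by \<delta> (x \<ominus> y))"
proof -
  have "dist x y < \<epsilon> \<longleftrightarrow> min (Inf (ereal ` {\<delta> \<in> K. 0 \<le> \<delta> \<and> bounded_by \<delta> (x \<ominus> y)})) 1 < ereal \<epsilon>"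
    using dist_eq_Inf[OF assms(1,2)] by (metis less_ereal.simps(1))
  also have "\<dots> \<longleftrightarrow> Inf (ereal ` {\<delta> \<in> K. 0 \<le> \<delta> \<and> bounded_by \<delta> (x \<ominus> y)}) < ereal \<epsilon>"
    using assms(3) by (auto simp: min_less_iff_disj one_ereal_def)
  also have "\<dots> \<longleftrightarrow> (\<exists>\<delta>\<in>K. 0 \<le> \<delta> \<and> \<delta> < \<epsilon> \<and> bounded_by \<delta> (x \<ominus> y))"
    by (auto simp: Inf_less_iff)
  finally show ?thesis .
qed

text \<open>
  Estimates between order intervals become estimates between distances. If the claimed inequality
  failed, then both distances on the right would be below thresholds that sum to \<open>dist u v \<le> 1\<close>; the
  resulting bounds would add up to a bound on \<open>u - v\<close> below \<open>dist u v\<close>.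
\<close>

lemma dist_le_sum_if_bounded:
  assumes c: "x \<in> carrier M" "y \<in> carrier M" "x' \<in> carrier M" "y' \<in> carrier M"
    "u \<in> carrier M" "v \<in> carrier M"
    and bounded: "\<And>\<delta> \<epsilon>. \<lbrakk>\<delta> \<in> K; 0 \<le> \<delta>; \<epsilon> \<in> K; 0 \<le> \<epsilon>; bounded_by \<delta> (x \<ominus> y); bounded_by \<epsilon> (x' \<ominus> y')\<rbrakk>
      \<Longrightarrow> bounded_by (\<delta> + \<epsilon>) (u \<ominus> v)"
  shows "dist u v \<le> dist x y + dist x' y'"
proof (rule ccontr)
  define h where "h = (dist u v - dist x y - dist x' y') / 2"
  assume "\<not> dist u v \<le> dist x y + dist x' y'"
  then have h: "h > 0" by (simp add: h_def)
  have sum: "(dist x y + h) + (dist x' y' + h) = dist u v" by (simp add: h_def field_simps)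
  then have le: "dist x y + h \<le> 1" "dist x' y' + h \<le> 1"
    using h dist_bounds(2)[of u v] dist_bounds(1)[of x y] dist_bounds(1)[of x' y'] by linarith+
  obtain \<delta> where \<delta>: "\<delta> \<in> K" "0 \<le> \<delta>" "\<delta> < dist x y + h" "bounded_by \<delta> (x \<ominus> y)"
    using dist_less_iff[OF c(1,2) le(1)] h by auto
  obtain \<epsilon> where \<epsilon>: "\<epsilon> \<in> K" "0 \<le> \<epsilon>" "\<epsilon> < dist x' y' + h" "bounded_by \<epsilon> (x' \<ominus> y')"
    using dist_less_iff[OF c(3,4) le(2)] h by auto
  have "dist u v < dist u v"
    using bounded[OF \<delta>(1,2) \<epsilon>(1,2) \<delta>(4) \<epsilon>(4)] \<delta> \<epsilon> sum scalar_closed(3)[OF \<delta>(1) \<epsilon>(1)] dist_bounds(2)[of u v]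
    by (subst dist_less_iff[OF c(5,6)]) (auto intro!: bexI[of _ "\<delta> + \<epsilon>"])
  then show False by simp
qed

lemma dist_refl: "x \<in> carrier M \<Longrightarrow> dist x x = 0"
proof (rule ccontr)
  assume x: "x \<in> carrier M" and "dist x x \<noteq> 0"
  then have pos: "0 < dist x x" using dist_bounds(1)[of x x] by simp
  have "bounded_by 0 (x \<ominus> x)"
    using x b_carrier by (simp add: bounded_by_def smult_zero_one M.minus_eq M.r_neg zero_nonneg)
  then have "dist x x < dist x x"
    using x pos dist_bounds(2)[of x x] scalar_closed(1) by (subst dist_less_iff) auto
  then show False by simp
qed

lemma dist_triangle:
  assumes "x \<in> carrier M" "y \<in> carrier M" "z \<in> carrier M"
  shows "dist x z \<le> dist x y + dist y z"
proof (rule dist_le_sum_if_bounded)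
  have "x \<ominus> z = (x \<ominus> y) \<oplus> (y \<ominus> z)" using assms by algebra
  then show "bounded_by (\<delta> + \<epsilon>) (x \<ominus> z)"
    if "\<delta> \<in> K" "0 \<le> \<delta>" "\<epsilon> \<in> K" "0 \<le> \<epsilon>" "bounded_by \<delta> (x \<ominus> y)" "bounded_by \<epsilon> (y \<ominus> z)" for \<delta> \<epsilon>
    using bounded_by_add that by simp
qed (use assms in simp_all)

lemma dist_add_le:
  assumes "x \<in> carrier M" "y \<in> carrier M" "x' \<in> carrier M" "y' \<in> carrier M"
  shows "dist (x \<oplus> x') (y \<oplus> y') \<le> dist x y + dist x' y'"
proof (rule dist_le_sum_if_bounded)
  have "(x \<oplus> x') \<ominus> (y \<oplus> y') = (x \<ominus> y) \<oplus> (x' \<ominus> y')" using assms by algebra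
  then show "bounded_by (\<delta> + \<epsilon>) ((x \<oplus> x') \<ominus> (y \<oplus> y'))"
    if "\<delta> \<in> K" "0 \<le> \<delta>" "\<epsilon> \<in> K" "0 \<le> \<epsilon>" "bounded_by \<delta> (x \<ominus> y)" "bounded_by \<epsilon> (x' \<ominus> y')" for \<delta> \<epsilon>
    using bounded_by_add that by simp
qed (use assms in simp_all)

text \<open>
  Interval bounds scale by \<open>\<bar>a\<bar>\<close>, but the truncation at \<open>1\<close> does not shrink with \<open>a\<close>; taking the
  factor \<open>max 1 \<bar>a\<bar>\<close> keeps the threshold \<open>dist (a x) (a y) / max 1 \<bar>a\<bar>\<close> at most \<open>1\<close>.
\<close>

lemma dist_smult_le:
  assumes "a \<in> K" "x \<in> carrier M" "y \<in> carrier M"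
  shows "dist (a \<odot>\<^bsub>M\<^esub> x) (a \<odot>\<^bsub>M\<^esub> y) \<le> max 1 \<bar>a\<bar> * dist x y"
proof (rule ccontr)
  let ?c = "max 1 \<bar>a\<bar>" and ?e = "dist (a \<odot>\<^bsub>M\<^esub> x) (a \<odot>\<^bsub>M\<^esub> y)"
  assume "\<not> ?e \<le> ?c * dist x y"
  then have "dist x y < ?e / ?c" by (simp add: field_simps)
  moreover have "?e / ?c \<le> 1" using dist_bounds(2)[of "a \<odot>\<^bsub>M\<^esub> x" "a \<odot>\<^bsub>M\<^esub> y"] by (simp add: field_simps)
  ultimately obtain \<delta> where \<delta>: "\<delta> \<in> K" "0 \<le> \<delta>" "\<delta> < ?e / ?c" "bounded_by \<delta> (x \<ominus> y)"
    using dist_less_iff[OF assms(2,3)] by auto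
  have "\<bar>a\<bar> * \<delta> \<le> ?c * \<delta>" using \<delta>(2) by (intro mult_right_mono) auto
  also have "\<dots> < ?e" using \<delta>(3) by (simp add: field_simps)
  finally have "\<bar>a\<bar> * \<delta> < ?e" .
  moreover have "bounded_by (\<bar>a\<bar> * \<delta>) (a \<odot>\<^bsub>M\<^esub> x \<ominus> a \<odot>\<^bsub>M\<^esub> y)"
    using bounded_by_smult[OF \<delta>(1) assms(1) \<delta>(4)] assms by (simp add: smult_diff_right)
  ultimately have "?e < ?e"
    using assms \<delta> dist_bounds(2)[of "a \<odot>\<^bsub>M\<^esub> x" "a \<odot>\<^bsub>M\<^esub> y"] scalar_closed(4)[OF scalar_abs[OF assms(1)] \<delta>(1)]
    by (subst dist_less_iff) (auto intro!: bexI[of _ "\<bar>a\<bar> * \<delta>"])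
  then show False by simp
qed

lemma dist_commute: "dist x y = dist y x"
proof -
  have "dist u v \<le> dist v u" if c: "u \<in> carrier M" "v \<in> carrier M" for u v
  proof -
    \<comment> \<open>The summand \<open>dist u u = 0\<close> only serves to fit the inequality into the two-term estimate.\<close>
    have "dist u v \<le> dist v u + dist u u"
    proof (rule dist_le_sum_if_bounded)
      fix \<delta> \<epsilon> assume \<delta>: "\<delta> \<in> K" "0 \<le> \<delta>" "\<epsilon> \<in> K" "0 \<le> \<epsilon>" "bounded_by \<delta> (v \<ominus> u)" "bounded_by \<epsilon> (u \<ominus> u)"
      then have "bounded_by (\<delta> + \<epsilon>) (\<ominus> (v \<ominus> u) \<oplus> (u \<ominus> u))"
        by (intro bounded_by_add bounded_by_uminus)
      moreover have "\<ominus> (v \<ominus> u) \<oplus> (u \<ominus> u) = u \<ominus> v" using c by algebra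
      ultimately show "bounded_by (\<delta> + \<epsilon>) (u \<ominus> v)" by simp
    qed (use c in simp_all)
    then show ?thesis using c by (simp add: dist_refl)
  qed
  then show ?thesis
    by (cases "x \<in> carrier M \<and> y \<in> carrier M") (force simp: b_dist_def intro: antisym)+
qed

sublocale pm: pseudo_metric "carrier M" dist
  by (intro pseudo_metric.intro dist_bounds dist_commute dist_refl dist_triangle)

end

section \<open>The vector space structure on the completion\<close>

context b_topology
begin

abbreviation "Cauchy_seq \<equiv> pm_Cauchy (carrier M) dist"
abbreviation "cls \<equiv> cauchy_class (carrier M) dist"
abbreviation "C \<equiv> b_completion K M b"
abbreviation "iota \<equiv> natural_map K M b"

lemma Cauchy_add:
  assumes "Cauchy_seq \<sigma>" "Cauchy_seq \<tau>"
  shows "Cauchy_seq (\<lambda>n. \<sigma> n \<oplus> \<tau> n)"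
  using assms[THEN pm.CauchyD]
  by (intro pm_Cauchy_dominated[OF assms, where c = 1]) (simp_all add: dist_add_le)

lemma Cauchy_smult:
  assumes "a \<in> K" "Cauchy_seq \<sigma>"
  shows "Cauchy_seq (\<lambda>n. a \<odot>\<^bsub>M\<^esub> \<sigma> n)"
proof (rule pm_Cauchy_dominated[OF assms(2) assms(2), where c = "max 1 \<bar>a\<bar>"])
  fix m n
  have "dist (a \<odot>\<^bsub>M\<^esub> \<sigma> m) (a \<odot>\<^bsub>M\<^esub> \<sigma> n) \<le> max 1 \<bar>a\<bar> * dist (\<sigma> m) (\<sigma> n)"
    using assms pm.CauchyD by (intro dist_smult_le) auto
  also have "\<dots> \<le> max 1 \<bar>a\<bar> * (dist (\<sigma> m) (\<sigma> n) + dist (\<sigma> m) (\<sigma> n))"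
    using dist_bounds(1) by (intro mult_left_mono) auto
  finally show "dist (a \<odot>\<^bsub>M\<^esub> \<sigma> m) (a \<odot>\<^bsub>M\<^esub> \<sigma> n) \<le> \<dots>" .
qed (use assms pm.CauchyD in auto)

lemma Cauchy_uminus:
  assumes "Cauchy_seq \<sigma>"
  shows "Cauchy_seq (\<lambda>n. \<ominus> \<sigma> n)"
  using Cauchy_smult[of "- 1" \<sigma>] assms pm.CauchyD[OF assms] scalar_closed(2)
  by (simp add: smult_uminus smult_zero_one scalar_uminus)

lemma Cauchy_diff:
  assumes "Cauchy_seq \<sigma>" "Cauchy_seq \<tau>"
  shows "Cauchy_seq (\<lambda>n. \<sigma> n \<ominus> \<tau> n)"
  using Cauchy_add[OF assms(1) Cauchy_uminus[OF assms(2)]] by (simp add: M.minus_eq)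

lemma C_carrier: "carrier C = completion_set (carrier M) dist"
  by (simp add: b_completion_def Let_def)

lemma C_zero: "\<zero>\<^bsub>C\<^esub> = cls (\<lambda>n. \<zero>)"
  by (simp add: b_completion_def Let_def)

lemma cls_add_cong:
  assumes "Cauchy_seq \<sigma>" "Cauchy_seq \<tau>" "Cauchy_seq \<sigma>'" "Cauchy_seq \<tau>'"
    and "cls \<sigma>' = cls \<sigma>" "cls \<tau>' = cls \<tau>"
  shows "cls (\<lambda>n. \<sigma>' n \<oplus> \<tau>' n) = cls (\<lambda>n. \<sigma> n \<oplus> \<tau> n)"
proof (subst pm.cls_eq_iff)
  have "(\<lambda>n. dist (\<sigma>' n) (\<sigma> n) + dist (\<tau>' n) (\<tau> n)) \<longlonglongrightarrow> 0 + 0"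
    using assms by (intro tendsto_add pm.cls_eq_iff[THEN iffD1])
  then show "(\<lambda>n. dist (\<sigma>' n \<oplus> \<tau>' n) (\<sigma> n \<oplus> \<tau> n)) \<longlonglongrightarrow> 0"
    unfolding add_0_left
    by (rule null_squeeze[OF _ dist_bounds(1) dist_add_le]) (simp_all add: assms(1-4)[THEN pm.CauchyD])
qed (intro Cauchy_add assms)+

lemma cls_smult_cong:
  assumes "a \<in> K" "Cauchy_seq \<sigma>" "Cauchy_seq \<sigma>'" and "cls \<sigma>' = cls \<sigma>"
  shows "cls (\<lambda>n. a \<odot>\<^bsub>M\<^esub> \<sigma>' n) = cls (\<lambda>n. a \<odot>\<^bsub>M\<^esub> \<sigma> n)"
proof (subst pm.cls_eq_iff)
  have "(\<lambda>n. max 1 \<bar>a\<bar> * dist (\<sigma>' n) (\<sigma> n)) \<longlonglongrightarrow> 0"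
    using assms by (intro tendsto_mult_right_zero pm.cls_eq_iff[THEN iffD1])
  then show "(\<lambda>n. dist (a \<odot>\<^bsub>M\<^esub> \<sigma>' n) (a \<odot>\<^bsub>M\<^esub> \<sigma> n)) \<longlonglongrightarrow> 0"
    by (rule null_squeeze[OF _ dist_bounds(1) dist_smult_le])
      (simp_all add: assms(1) assms(2,3)[THEN pm.CauchyD])
qed (intro Cauchy_smult assms)+

lemma C_add:
  assumes "Cauchy_seq \<sigma>" "Cauchy_seq \<tau>"
  shows "cls \<sigma> \<oplus>\<^bsub>C\<^esub> cls \<tau> = cls (\<lambda>n. \<sigma> n \<oplus> \<tau> n)"
proof -
  have inner: "(\<Union>\<tau>'\<in>cls \<tau>. cls (\<lambda>n. \<sigma>' n \<oplus> \<tau>' n)) = cls (\<lambda>n. \<sigma>' n \<oplus> \<tau> n)"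
    if "Cauchy_seq \<sigma>'" for \<sigma>'
    using that assms by (intro pm.UN_cls cls_add_cong HOL.refl)
  have "cls \<sigma> \<oplus>\<^bsub>C\<^esub> cls \<tau> = (\<Union>\<sigma>'\<in>cls \<sigma>. \<Union>\<tau>'\<in>cls \<tau>. cls (\<lambda>n. \<sigma>' n \<oplus> \<tau>' n))"
    by (simp add: b_completion_def Let_def)
  also have "\<dots> = (\<Union>\<sigma>'\<in>cls \<sigma>. cls (\<lambda>n. \<sigma>' n \<oplus> \<tau> n))"
    by (intro SUP_cong HOL.refl inner) (simp add: pm.mem_cls_iff assms)
  also have "\<dots> = cls (\<lambda>n. \<sigma> n \<oplus> \<tau> n)"
    using assms by (intro pm.UN_cls cls_add_cong HOL.refl)
  finally show ?thesis .
qed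

lemma C_smult:
  assumes "a \<in> K" "Cauchy_seq \<sigma>"
  shows "a \<odot>\<^bsub>C\<^esub> cls \<sigma> = cls (\<lambda>n. a \<odot>\<^bsub>M\<^esub> \<sigma> n)"
proof -
  have "a \<odot>\<^bsub>C\<^esub> cls \<sigma> = (\<Union>\<sigma>'\<in>cls \<sigma>. cls (\<lambda>n. a \<odot>\<^bsub>M\<^esub> \<sigma>' n))"
    by (simp add: b_completion_def Let_def)
  also have "\<dots> = cls (\<lambda>n. a \<odot>\<^bsub>M\<^esub> \<sigma> n)"
    using assms by (intro pm.UN_cls cls_smult_cong)
  finally show ?thesis .
qed

lemma C_cases:
  assumes "X \<in> carrier C"
  obtains \<sigma> where "Cauchy_seq \<sigma>" "X = cls \<sigma>"
  using assms by (auto simp: C_carrier pm.completion_set_iff)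

lemma cls_carrier: "Cauchy_seq \<sigma> \<Longrightarrow> cls \<sigma> \<in> carrier C"
  by (simp add: C_carrier pm.cls_in_completion_set)

lemma Cauchy_zero: "Cauchy_seq (\<lambda>n. \<zero>)"
  by (simp add: pm.Cauchy_const)

lemma module_C: "module (scalar_field K) C"
proof (rule moduleI)
  show "cring (scalar_field K)" by (rule R.is_cring)
  show "abelian_group C"
  proof (rule abelian_groupI)
    fix X Y assume "X \<in> carrier C" "Y \<in> carrier C"
    then obtain \<sigma> \<tau> where c: "Cauchy_seq \<sigma>" "Cauchy_seq \<tau>" and X: "X = cls \<sigma>" "Y = cls \<tau>"
      by (metis C_cases)
    show "X \<oplus>\<^bsub>C\<^esub> Y \<in> carrier C"
      using c by (simp add: X C_add Cauchy_add cls_carrier)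
    show "X \<oplus>\<^bsub>C\<^esub> Y = Y \<oplus>\<^bsub>C\<^esub> X"
      using c c[THEN pm.CauchyD] by (simp add: X C_add M.a_comm)
    fix Z assume "Z \<in> carrier C"
    then obtain \<upsilon> where u: "Cauchy_seq \<upsilon>" and Z: "Z = cls \<upsilon>"
      by (metis C_cases)
    show "X \<oplus>\<^bsub>C\<^esub> Y \<oplus>\<^bsub>C\<^esub> Z = X \<oplus>\<^bsub>C\<^esub> (Y \<oplus>\<^bsub>C\<^esub> Z)"
      using c u c[THEN pm.CauchyD] u[THEN pm.CauchyD] by (simp add: X Z C_add Cauchy_add M.a_assoc)
  next
    show "\<zero>\<^bsub>C\<^esub> \<in> carrier C"
      by (simp add: C_zero cls_carrier Cauchy_zero)
    fix X assume "X \<in> carrier C"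
    then obtain \<sigma> where c: "Cauchy_seq \<sigma>" and X: "X = cls \<sigma>" by (rule C_cases)
    show "\<zero>\<^bsub>C\<^esub> \<oplus>\<^bsub>C\<^esub> X = X"
      using c c[THEN pm.CauchyD] by (simp add: X C_zero C_add Cauchy_zero)
    show "\<exists>Y\<in>carrier C. Y \<oplus>\<^bsub>C\<^esub> X = \<zero>\<^bsub>C\<^esub>"
      using c c[THEN pm.CauchyD]
      by (intro bexI[of _ "cls (\<lambda>n. \<ominus> \<sigma> n)"])
        (simp_all add: X C_zero C_add Cauchy_uminus cls_carrier M.l_neg)
  qed
next
  fix a X assume "a \<in> carrier (scalar_field K)" "X \<in> carrier C"
  then obtain \<sigma> where a: "a \<in> K" and c: "Cauchy_seq \<sigma>" and X: "X = cls \<sigma>"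
    by (auto elim: C_cases)
  note cM = c[THEN pm.CauchyD]
  show "a \<odot>\<^bsub>C\<^esub> X \<in> carrier C"
    using a c by (simp add: X C_smult Cauchy_smult cls_carrier)
next
  fix a c' X assume "a \<in> carrier (scalar_field K)" "c' \<in> carrier (scalar_field K)" "X \<in> carrier C"
  then obtain \<sigma> where a: "a \<in> K" "c' \<in> K" and c: "Cauchy_seq \<sigma>" and X: "X = cls \<sigma>"
    by (auto elim: C_cases)
  note cM = c[THEN pm.CauchyD]
  show "(a \<oplus>\<^bsub>scalar_field K\<^esub> c') \<odot>\<^bsub>C\<^esub> X = a \<odot>\<^bsub>C\<^esub> X \<oplus>\<^bsub>C\<^esub> c' \<odot>\<^bsub>C\<^esub> X"
    using a c cM by (simp add: X C_smult C_add Cauchy_smult scalar_closed smult_add_left)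
  show "(a \<otimes>\<^bsub>scalar_field K\<^esub> c') \<odot>\<^bsub>C\<^esub> X = a \<odot>\<^bsub>C\<^esub> (c' \<odot>\<^bsub>C\<^esub> X)"
    using a c cM by (simp add: X C_smult Cauchy_smult scalar_closed smult_smult)
next
  fix a X Y assume "a \<in> carrier (scalar_field K)" "X \<in> carrier C" "Y \<in> carrier C"
  then obtain \<sigma> \<tau> where a: "a \<in> K" and c: "Cauchy_seq \<sigma>" "Cauchy_seq \<tau>"
    and X: "X = cls \<sigma>" "Y = cls \<tau>"
    by (metis C_cases scalar_field_simps(1))
  note cM = c[THEN pm.CauchyD]
  show "a \<odot>\<^bsub>C\<^esub> (X \<oplus>\<^bsub>C\<^esub> Y) = a \<odot>\<^bsub>C\<^esub> X \<oplus>\<^bsub>C\<^esub> a \<odot>\<^bsub>C\<^esub> Y"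
    using a c cM by (simp add: X C_smult C_add Cauchy_add Cauchy_smult smult_add_right)
next
  fix X assume "X \<in> carrier C"
  then obtain \<sigma> where c: "Cauchy_seq \<sigma>" and X: "X = cls \<sigma>" by (rule C_cases)
  show "\<one>\<^bsub>scalar_field K\<^esub> \<odot>\<^bsub>C\<^esub> X = X"
    using c c[THEN pm.CauchyD] by (simp add: X C_smult scalar_closed smult_zero_one)
qed

sublocale C: real_module K C
  by (rule real_module.intro) (rule module_C)

lemma C_uminus:
  assumes "Cauchy_seq \<sigma>"
  shows "\<ominus>\<^bsub>C\<^esub> cls \<sigma> = cls (\<lambda>n. \<ominus> \<sigma> n)"
proof (rule C.M.minus_equality)
  show "cls (\<lambda>n. \<ominus> \<sigma> n) \<oplus>\<^bsub>C\<^esub> cls \<sigma> = \<zero>\<^bsub>C\<^esub>"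
    using assms[THEN pm.CauchyD] by (simp add: C_zero C_add[OF Cauchy_uminus] assms M.l_neg)
qed (intro cls_carrier Cauchy_uminus assms)+

lemma C_diff:
  assumes "Cauchy_seq \<sigma>" "Cauchy_seq \<tau>"
  shows "cls \<sigma> \<ominus>\<^bsub>C\<^esub> cls \<tau> = cls (\<lambda>n. \<sigma> n \<ominus> \<tau> n)"
  by (simp only: C.M.minus_eq C_uminus C_add Cauchy_uminus M.minus_eq assms)

lemma natural_map_eq: "iota x = cls (\<lambda>n. x)"
  by (simp add: natural_map_def completion_map_def)

text \<open>
  Reduces membership in a completed subset to representing sequences, on which the vector space
  operations act term by term.
\<close>

lemma mem_subset_completion_iff:
  assumes "A \<subseteq> carrier M"
  shows "X \<in> subset_completion K M b A \<longleftrightarrow> (\<exists>\<sigma>. Cauchy_seq \<sigma> \<and> range \<sigma> \<subseteq> A \<and> X = cls \<sigma>)"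
  using pm.mem_closure_of_image_iff[OF assms]
  by (simp add: subset_completion_def b_completion_topology_def natural_map_def)

lemma natural_map_mem_subset_completion:
  assumes "A \<subseteq> carrier M" "x \<in> A"
  shows "iota x \<in> subset_completion K M b A"
proof -
  have "Cauchy_seq (\<lambda>n. x)" "range (\<lambda>n::nat. x) \<subseteq> A"
    using assms by (auto intro: pm.Cauchy_const)
  then show ?thesis
    unfolding mem_subset_completion_iff[OF assms(1)] natural_map_eq by blast
qed

lemma hausdorff_complete_subset_completion:
  "A \<subseteq> carrier M \<Longrightarrow> hausdorff_complete (subset_completion K M b A) (b_completion_dist K M b)"
  using pm.hausdorff_complete_closure_of_image
  by (simp add: subset_completion_def b_completion_topology_def natural_map_def b_completion_dist_def)

lemma is_cone_subset_completion:
  assumes "is_cone K M A"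
  shows "is_cone K C (subset_completion K M b A)"
proof -
  have A: "A \<subseteq> carrier M" "\<And>x y. x \<in> A \<Longrightarrow> y \<in> A \<Longrightarrow> x \<oplus> y \<in> A"
    "\<And>a x. a \<in> K \<Longrightarrow> 0 \<le> a \<Longrightarrow> x \<in> A \<Longrightarrow> a \<odot>\<^bsub>M\<^esub> x \<in> A"
    using assms by (auto simp: is_cone_def)
  note iff = mem_subset_completion_iff[OF A(1)]
  show ?thesis
    unfolding is_cone_def
  proof (intro conjI ballI allI impI subsetI)
    show "X \<in> carrier C" if "X \<in> subset_completion K M b A" for X
    proof -
      from that[unfolded iff] obtain \<sigma> where "Cauchy_seq \<sigma>" "X = cls \<sigma>" by blast
      then show ?thesis by (simp only: cls_carrier)
    qed
    show "X \<oplus>\<^bsub>C\<^esub> Y \<in> subset_completion K M b A"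
      if XY: "X \<in> subset_completion K M b A" "Y \<in> subset_completion K M b A" for X Y
    proof -
      obtain \<sigma> \<tau> where s: "Cauchy_seq \<sigma>" "range \<sigma> \<subseteq> A" "X = cls \<sigma>"
        and t: "Cauchy_seq \<tau>" "range \<tau> \<subseteq> A" "Y = cls \<tau>"
        using XY[unfolded iff] by blast
      then show ?thesis
        unfolding iff
        by (intro exI[of _ "\<lambda>n. \<sigma> n \<oplus> \<tau> n"])
          (simp add: C_add Cauchy_add image_subset_iff A(2))
    qed
    show "a \<odot>\<^bsub>C\<^esub> X \<in> subset_completion K M b A"
      if a: "a \<in> K" "0 \<le> a" and X: "X \<in> subset_completion K M b A" for a X
    proof -
      obtain \<sigma> where s: "Cauchy_seq \<sigma>" "range \<sigma> \<subseteq> A" "X = cls \<sigma>"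
        using X[unfolded iff] by blast
      then show ?thesis
        unfolding iff
        by (intro exI[of _ "\<lambda>n. a \<odot>\<^bsub>M\<^esub> \<sigma> n"])
          (simp add: C_smult Cauchy_smult image_subset_iff a A(3))
    qed
  qed
qed

text \<open>
  Let \<open>\<sigma>\<close> and \<open>\<tau>\<close> be nonnegative representatives of \<open>X\<close> and \<open>- X\<close>. Then \<open>\<sigma> + \<tau>\<close> tends to \<open>0\<close>, and
  \<open>0 \<le> \<sigma> \<le> \<sigma> + \<tau>\<close> makes every interval bound on \<open>\<sigma> + \<tau>\<close> one on \<open>\<sigma>\<close>.
\<close>

lemma completed_nonneg_pointed:
  assumes "X \<in> subset_completion K M b P" "\<ominus>\<^bsub>C\<^esub> X \<in> subset_completion K M b P"
  shows "X = \<zero>\<^bsub>C\<^esub>"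
proof -
  have P: "P \<subseteq> carrier M" using nonneg_carrier by blast
  obtain \<sigma> \<tau> where s: "Cauchy_seq \<sigma>" "range \<sigma> \<subseteq> P" "X = cls \<sigma>"
    and t: "Cauchy_seq \<tau>" "range \<tau> \<subseteq> P" "\<ominus>\<^bsub>C\<^esub> X = cls \<tau>"
    using assms[unfolded mem_subset_completion_iff[OF P]] by blast
  note cM = s(1)[THEN pm.CauchyD] t(1)[THEN pm.CauchyD]
  have "cls (\<lambda>n. \<sigma> n \<oplus> \<tau> n) = X \<oplus>\<^bsub>C\<^esub> \<ominus>\<^bsub>C\<^esub> X"
    by (simp only: t(3)) (simp only: s(3) C_add[OF s(1) t(1)])
  also have "\<dots> = cls (\<lambda>n. \<zero>)"
    using cls_carrier[OF s(1)] s(3) by (simp add: C.M.r_neg C_zero)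
  finally have "cls (\<lambda>n. \<sigma> n \<oplus> \<tau> n) = cls (\<lambda>n. \<zero>)" .
  then have lim: "(\<lambda>n. dist (\<sigma> n \<oplus> \<tau> n) \<zero>) \<longlonglongrightarrow> 0"
    using s t by (subst (asm) pm.cls_eq_iff) (simp_all add: Cauchy_add Cauchy_zero)
  have "dist (\<sigma> n) \<zero> \<le> dist (\<sigma> n \<oplus> \<tau> n) \<zero>" for n
  proof -
    have P: "\<sigma> n \<in> P" "\<tau> n \<in> P" using s t by auto
    have "dist (\<sigma> n) \<zero> \<le> dist (\<sigma> n \<oplus> \<tau> n) \<zero> + dist \<zero> \<zero>"
    proof (rule dist_le_sum_if_bounded)
      fix \<delta> \<epsilon> assume d: "\<delta> \<in> K" "0 \<le> \<delta>" "\<epsilon> \<in> K" "bounded_by \<delta> ((\<sigma> n \<oplus> \<tau> n) \<ominus> \<zero>)"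
        and e: "bounded_by \<epsilon> (\<zero> \<ominus> \<zero>)"
      have "(\<sigma> n \<oplus> \<tau> n) \<ominus> \<zero> = \<sigma> n \<oplus> \<tau> n"
        using cM[of n] by algebra
      then have "bounded_by \<delta> (\<sigma> n)"
        using d(4) by (intro bounded_by_smaller[OF d(1,2) P]) simp
      then have "bounded_by (\<delta> + \<epsilon>) (\<sigma> n \<oplus> (\<zero> \<ominus> \<zero>))"
        using d e by (intro bounded_by_add)
      moreover have "\<sigma> n \<oplus> (\<zero> \<ominus> \<zero>) = \<sigma> n \<ominus> \<zero>"
        using cM[of n] by algebra
      ultimately show "bounded_by (\<delta> + \<epsilon>) (\<sigma> n \<ominus> \<zero>)" by simp
    qed (simp_all add: cM)
    then show ?thesis by (simp add: dist_refl)
  qed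
  then have "(\<lambda>n. dist (\<sigma> n) \<zero>) \<longlonglongrightarrow> 0"
    by (rule null_squeeze[OF lim dist_bounds(1)])
  then show ?thesis
    using s Cauchy_zero by (simp add: C_zero pm.cls_eq_iff)
qed

end

section \<open>The completed divisorial space\<close>

text \<open>
  The module axioms do not mention the ring product and unit of the record, so two records that agree
  on the remaining fields are modules simultaneously, even if their types differ.
\<close>

lemma module_cong:
  assumes "module R A" and "carrier B = carrier A" "add B = add A" "zero B = zero A" "smult B = smult A"
  shows "module R B"
proof -
  interpret A: module R A by fact
  have "\<exists>y\<in>carrier A. y \<oplus>\<^bsub>A\<^esub> x = \<zero>\<^bsub>A\<^esub>" if "x \<in> carrier A" for x
    using that A.M.l_neg[of x] by (intro bexI[of _ "\<ominus>\<^bsub>A\<^esub> x"]) simp_all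
  then have "abelian_group B"
    using assms(2-4) by (intro abelian_groupI) (simp_all add: A.M.a_ac)
  then show ?thesis
    by (intro moduleI A.R.is_cring)
      (simp_all add: assms(2-) A.smult_l_distr A.smult_r_distr A.smult_assoc1)
qed

locale divisorial_b_topology = abstract_divisorial_space K M N + b_topology K M b
  for K and M :: "(real, 'a) ordered_module" (structure) and N b
begin

abbreviation "Nh \<equiv> subset_completion K M b N"
abbreviation "Ph \<equiv> hat_nonneg K M N b"
abbreviation "H \<equiv> hat_space K M N b"

lemma N_subset: "N \<subseteq> carrier M"
  using cone by (simp add: is_cone_def)

lemma N_nonempty: "N \<noteq> {}"
  using generating M.zero_closed by (auto simp: differences_def)

lemma is_cone_Nh: "is_cone K C Nh"
  by (rule is_cone_subset_completion[OF cone])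

lemma Nh_nonempty: "Nh \<noteq> {}"
  using natural_map_mem_subset_completion[OF N_subset] N_nonempty by blast

lemma submodule_hat_carrier: "submodule (hat_carrier K M N b) (scalar_field K) C"
  unfolding hat_carrier_def by (rule C.submodule_differences[OF is_cone_Nh Nh_nonempty])

lemmas hat_carrierE = C.submoduleE[OF submodule_hat_carrier]

lemma H_simps:
  "carrier H = hat_carrier K M N b" "add H = add C" "zero H = zero C" "smult H = smult C"
  "X \<preceq>\<^bsub>H\<^esub> Y \<longleftrightarrow> Y \<ominus>\<^bsub>C\<^esub> X \<in> Ph"
  by (simp_all add: hat_space_def Let_def)

lemma module_H: "module (scalar_field K) H"
  by (rule module_cong[OF submodule.submodule_is_module[OF submodule_hat_carrier module_C]])
    (simp_all add: H_simps)

sublocale H: real_module K H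
  by (rule real_module.intro) (rule module_H)

text \<open>
  Negation in a record is defined from its carrier, so it has to be compared between the completion and
  its subspace.
\<close>

lemma H_uminus:
  assumes "X \<in> carrier H"
  shows "\<ominus>\<^bsub>H\<^esub> X = \<ominus>\<^bsub>C\<^esub> X"
proof (rule H.M.minus_equality)
  have X: "X \<in> carrier C" using assms hat_carrierE(1) by (auto simp: H_simps)
  show "\<ominus>\<^bsub>C\<^esub> X \<oplus>\<^bsub>H\<^esub> X = \<zero>\<^bsub>H\<^esub>"
    using C.M.l_neg[OF X] by (simp add: H_simps)
  show "\<ominus>\<^bsub>C\<^esub> X \<in> carrier H"
    using assms hat_carrierE(3) by (simp add: H_simps)
qed (rule assms)

lemma H_diff: "Y \<in> carrier H \<Longrightarrow> X \<ominus>\<^bsub>H\<^esub> Y = X \<ominus>\<^bsub>C\<^esub> Y"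
  by (simp add: a_minus_def H_uminus H_simps(2))

lemma is_cone_Ph: "is_cone K C Ph"
  using is_cone_subset_completion[OF is_cone_nonneg_part] hat_carrierE(4,5)
  by (auto simp: is_cone_def hat_nonneg_def)

text \<open>
  Writing \<open>X = (X + X) - X\<close> exhibits \<open>X\<close> as a difference of elements of the cone.
\<close>

lemma Nh_subset_H: "Nh \<subseteq> carrier H"
proof
  fix X assume X: "X \<in> Nh"
  then have XC: "X \<in> carrier C" using is_cone_Nh by (auto simp: is_cone_def)
  have "X \<oplus>\<^bsub>C\<^esub> X \<in> Nh" using X is_cone_Nh by (simp add: is_cone_def)
  moreover have "X = (X \<oplus>\<^bsub>C\<^esub> X) \<ominus>\<^bsub>C\<^esub> X"
    using XC by (simp add: C.M.minus_eq C.M.a_assoc C.M.r_neg)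
  ultimately show "X \<in> carrier H"
    using X by (auto simp: H_simps hat_carrier_def differences_def)
qed

lemma ordered_vector_space_H: "ordered_vector_space K H" and nonneg_part_H: "nonneg_part H = Ph"
proof -
  have zero: "\<zero>\<^bsub>C\<^esub> \<in> Ph"
  proof -
    have "iota \<zero> \<in> subset_completion K M b P"
      using nonneg_carrier zero_nonneg by (intro natural_map_mem_subset_completion) auto
    then show ?thesis
      using H.M.zero_closed by (simp add: hat_nonneg_def natural_map_eq C_zero[symmetric] H_simps)
  qed
  have cone: "is_cone K H Ph"
    using is_cone_Ph by (auto simp: is_cone_def H_simps hat_nonneg_def)
  have pointed: "X = \<zero>\<^bsub>H\<^esub>" if "X \<in> Ph" "\<ominus>\<^bsub>H\<^esub> X \<in> Ph" for X
  proof -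
    have "X \<in> carrier H" using that(1) by (simp add: H_simps hat_nonneg_def)
    then show ?thesis
      using that completed_nonneg_pointed[of X] by (simp add: H_simps(3) H_uminus hat_nonneg_def)
  qed
  have le: "X \<preceq>\<^bsub>H\<^esub> Y \<longleftrightarrow> Y \<ominus>\<^bsub>H\<^esub> X \<in> Ph" if "X \<in> carrier H" "Y \<in> carrier H" for X Y
    using that by (simp add: H_simps(5) H_diff)
  show "ordered_vector_space K H" "nonneg_part H = Ph"
    using ordered_vector_space_of_cone[OF module_H cone _ pointed le] zero by (simp_all add: H_simps(3))
qed

lemma abstract_divisorial_space_H: "abstract_divisorial_space K H Nh"
proof -
  have "is_cone K H Nh"
    using is_cone_Nh Nh_subset_H unfolding is_cone_def H_simps by blast
  moreover have "carrier H = differences H Nh"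
  proof -
    have "differences H Nh = differences C Nh"
      unfolding differences_def
      by (intro Collect_cong ex_cong1) (auto simp: H_diff[OF subsetD[OF Nh_subset_H]])
    then show ?thesis by (simp add: H_simps hat_carrier_def)
  qed
  ultimately show ?thesis
    by (intro abstract_divisorial_space.intro ordered_vector_space_H abstract_divisorial_space_axioms.intro)
qed

lemma natural_map_add: "\<lbrakk>x \<in> carrier M; y \<in> carrier M\<rbrakk> \<Longrightarrow> iota (x \<oplus> y) = iota x \<oplus>\<^bsub>C\<^esub> iota y"
  by (simp add: natural_map_eq C_add pm.Cauchy_const)

lemma natural_map_smult: "\<lbrakk>a \<in> K; x \<in> carrier M\<rbrakk> \<Longrightarrow> iota (a \<odot>\<^bsub>M\<^esub> x) = a \<odot>\<^bsub>C\<^esub> iota x"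
  by (simp add: natural_map_eq C_smult pm.Cauchy_const)

lemma natural_map_carrier:
  assumes "x \<in> carrier M"
  shows "iota x \<in> carrier H"
proof -
  obtain y z where x: "x = y \<ominus> z" and yz: "y \<in> N" "z \<in> N"
    using assms unfolding generating by (auto simp: differences_def)
  then have "iota x = iota y \<ominus>\<^bsub>C\<^esub> iota z"
    using subsetD[OF N_subset] by (simp only: natural_map_eq C_diff pm.Cauchy_const)
  moreover have "iota y \<in> Nh" "iota z \<in> Nh"
    using yz natural_map_mem_subset_completion[OF N_subset] by auto
  ultimately show ?thesis
    by (auto simp: H_simps hat_carrier_def differences_def)
qed

lemma natural_map_hom: "iota \<in> divisorial_hom K M N H Nh"
proof -
  have "iota \<in> hom (add_monoid M) (add_monoid H)"
    by (auto simp: hom_def natural_map_carrier natural_map_add H_simps(2))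
  moreover have "iota x \<in> Ph" if "x \<in> P" for x
    using that natural_map_mem_subset_completion[of P x] nonneg_carrier natural_map_carrier[of x]
    by (auto simp: hat_nonneg_def H_simps)
  moreover have "iota x \<in> Nh" if "x \<in> N" for x
    using natural_map_mem_subset_completion[OF N_subset that] .
  ultimately show ?thesis
    by (auto simp: divisorial_hom_def nonneg_part_H natural_map_smult H_simps(4))
qed

lemma closedin_Ph: "closedin (subtopology (b_completion_topology K M b) (carrier H)) Ph"
proof -
  have "closedin (b_completion_topology K M b) (subset_completion K M b P)"
    by (simp add: subset_completion_def)
  then show ?thesis
    unfolding hat_nonneg_def H_simps(1)
    by (simp add: closedin_subtopology) blast
qed

lemma b_topology_H: "b_topology K H (iota b)"
proof -
  have "iota b \<in> nonneg_part H"
    using natural_map_hom b_nonneg by (auto simp: divisorial_hom_def)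
  then show ?thesis
    by (intro b_topology.intro ordered_vector_space_H b_topology_axioms.intro field)
qed

text \<open>
  The completed space carries two metrics: the completed one, and the one that its own order and the
  image of \<open>b\<close> define. If the first is below \<open>t\<close>, then the terms of suitable representatives satisfy
  \<open>- t b \<le> \<sigma> n - \<tau> n \<le> t b\<close>, and these inequalities pass to the classes because the completed
  nonnegative cone is closed. With the nonexpansion of morphisms this makes every morphism out of the
  completed space continuous for the completed metric.
\<close>

lemma dist_H_le:
  assumes "X \<in> carrier H" "Y \<in> carrier H"
  shows "b_dist K H (iota b) X Y \<le> b_completion_dist K M b X Y"
proof (rule ccontr)
  interpret Hb: b_topology K H "iota b" by (rule b_topology_H)
  let ?d = "b_dist K H (iota b) X Y" and ?D = "b_completion_dist K M b X Y"
  assume "\<not> ?d \<le> ?D"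
  then obtain t where t: "t \<in> K" "?D < t" "t < ?d"
    using scalar_dense[of ?D ?d] by auto
  have t1: "t \<le> 1" using t(3) Hb.dist_bounds(2)[of X Y] by linarith
  have XY: "X \<in> carrier C" "Y \<in> carrier C"
    using assms hat_carrierE(1) by (auto simp: H_simps)
  obtain \<sigma>0 \<tau>0 where s0: "Cauchy_seq \<sigma>0" "X = cls \<sigma>0" and t0: "Cauchy_seq \<tau>0" "Y = cls \<tau>0"
    using XY by (metis C_cases)
  have lim: "(\<lambda>n. dist (\<sigma>0 n) (\<tau>0 n)) \<longlonglongrightarrow> ?D"
    using pm.tendsto_completion_dist[OF s0(1) t0(1)] s0 t0 by (simp add: b_completion_dist_def)
  obtain k where k: "\<And>n. n \<ge> k \<Longrightarrow> dist (\<sigma>0 n) (\<tau>0 n) < t"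
    using order_tendstoD(2)[OF lim t(2)] by (auto simp: eventually_sequentially)
  \<comment> \<open>Shifted so that the bound holds for all terms.\<close>
  define \<sigma> where "\<sigma> = (\<lambda>n. \<sigma>0 (n + k))"
  define \<tau> where "\<tau> = (\<lambda>n. \<tau>0 (n + k))"
  have s: "Cauchy_seq \<sigma>" "X = cls \<sigma>" and u: "Cauchy_seq \<tau>" "Y = cls \<tau>"
    using pm.cls_shift[OF s0(1), of k] pm.cls_shift[OF t0(1), of k] s0 t0
    by (simp_all add: \<sigma>_def \<tau>_def)
  have "?D \<ge> 0"
    using lim dist_bounds(1) by (intro LIMSEQ_le_const[OF lim]) auto
  then have t_pos: "0 \<le> t" using t(2) by simp
  have bnd: "bounded_by t (\<sigma> n \<ominus> \<tau> n)" for n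
  proof -
    have "dist (\<sigma> n) (\<tau> n) < t" using k by (simp add: \<sigma>_def \<tau>_def)
    then obtain \<delta> where "\<delta> \<in> K" "\<delta> < t" "bounded_by \<delta> (\<sigma> n \<ominus> \<tau> n)"
      using dist_less_iff[OF pm.CauchyD[OF s(1)] pm.CauchyD[OF u(1)] t1] by auto
    then show ?thesis using t(1) bounded_by_mono[of \<delta> t] by simp
  qed
  have tb: "Cauchy_seq (\<lambda>n. t \<odot>\<^bsub>M\<^esub> b)" "t \<odot>\<^bsub>C\<^esub> iota b = cls (\<lambda>n. t \<odot>\<^bsub>M\<^esub> b)"
    using t(1) b_carrier by (simp_all add: pm.Cauchy_const natural_map_eq C_smult)
  have diff: "Cauchy_seq (\<lambda>n. \<sigma> n \<ominus> \<tau> n)" "X \<ominus>\<^bsub>C\<^esub> Y = cls (\<lambda>n. \<sigma> n \<ominus> \<tau> n)"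
    using s u by (simp_all add: Cauchy_diff C_diff)
  have PM: "P \<subseteq> carrier M" using nonneg_carrier by blast
  have H: "X \<ominus>\<^bsub>H\<^esub> Y \<in> carrier H" "t \<odot>\<^bsub>H\<^esub> iota b \<in> carrier H"
    using assms t(1) Hb.smult_b_carrier by simp_all
  have "t \<odot>\<^bsub>H\<^esub> iota b \<ominus>\<^bsub>H\<^esub> (X \<ominus>\<^bsub>H\<^esub> Y) \<in> Ph"
  proof -
    have "t \<odot>\<^bsub>H\<^esub> iota b \<ominus>\<^bsub>H\<^esub> (X \<ominus>\<^bsub>H\<^esub> Y) = cls (\<lambda>n. t \<odot>\<^bsub>M\<^esub> b \<ominus> (\<sigma> n \<ominus> \<tau> n))"
      using H assms C_diff[OF tb(1) diff(1)] by (simp add: H_diff H_simps(4) tb(2) diff(2))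
    moreover have "cls (\<lambda>n. t \<odot>\<^bsub>M\<^esub> b \<ominus> (\<sigma> n \<ominus> \<tau> n)) \<in> subset_completion K M b P"
      unfolding mem_subset_completion_iff[OF PM]
      using bnd Cauchy_diff[OF tb(1) diff(1)]
      by (intro exI[of _ "\<lambda>n. t \<odot>\<^bsub>M\<^esub> b \<ominus> (\<sigma> n \<ominus> \<tau> n)"]) (auto simp: bounded_by_def)
    moreover have "t \<odot>\<^bsub>H\<^esub> iota b \<ominus>\<^bsub>H\<^esub> (X \<ominus>\<^bsub>H\<^esub> Y) \<in> carrier H"
      using H by simp
    ultimately show ?thesis by (simp add: hat_nonneg_def H_simps(1))
  qed
  moreover have "t \<odot>\<^bsub>H\<^esub> iota b \<oplus>\<^bsub>H\<^esub> (X \<ominus>\<^bsub>H\<^esub> Y) \<in> Ph"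
  proof -
    have "t \<odot>\<^bsub>H\<^esub> iota b \<oplus>\<^bsub>H\<^esub> (X \<ominus>\<^bsub>H\<^esub> Y) = cls (\<lambda>n. t \<odot>\<^bsub>M\<^esub> b \<oplus> (\<sigma> n \<ominus> \<tau> n))"
      using H assms C_add[OF tb(1) diff(1)] by (simp add: H_diff H_simps(2,4) tb(2) diff(2))
    moreover have "cls (\<lambda>n. t \<odot>\<^bsub>M\<^esub> b \<oplus> (\<sigma> n \<ominus> \<tau> n)) \<in> subset_completion K M b P"
      unfolding mem_subset_completion_iff[OF PM]
      using bnd Cauchy_add[OF tb(1) diff(1)]
      by (intro exI[of _ "\<lambda>n. t \<odot>\<^bsub>M\<^esub> b \<oplus> (\<sigma> n \<ominus> \<tau> n)"]) (auto simp: bounded_by_def)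
    moreover have "t \<odot>\<^bsub>H\<^esub> iota b \<oplus>\<^bsub>H\<^esub> (X \<ominus>\<^bsub>H\<^esub> Y) \<in> carrier H"
      using H by simp
    ultimately show ?thesis by (simp add: hat_nonneg_def H_simps(1))
  qed
  ultimately have "Hb.bounded_by t (X \<ominus>\<^bsub>H\<^esub> Y)"
    using H by (simp add: Hb.bounded_by_def nonneg_part_H)
  then have "?d < ?d"
    using Hb.dist_less_iff[OF assms Hb.dist_bounds(2)] t t_pos by blast
  then show False by simp
qed

end

section \<open>Extending morphisms to the completion\<close>

lemma divisorial_homD:
  assumes "\<phi> \<in> divisorial_hom K M N M' N'"
  shows "x \<in> carrier M \<Longrightarrow> \<phi> x \<in> carrier M'"
    and "\<lbrakk>x \<in> carrier M; y \<in> carrier M\<rbrakk> \<Longrightarrow> \<phi> (x \<oplus>\<^bsub>M\<^esub> y) = \<phi> x \<oplus>\<^bsub>M'\<^esub> \<phi> y"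
    and "\<lbrakk>a \<in> K; x \<in> carrier M\<rbrakk> \<Longrightarrow> \<phi> (a \<odot>\<^bsub>M\<^esub> x) = a \<odot>\<^bsub>M'\<^esub> \<phi> x"
    and "x \<in> nonneg_part M \<Longrightarrow> \<phi> x \<in> nonneg_part M'"
    and "x \<in> N \<Longrightarrow> \<phi> x \<in> N'"
  using assms by (auto simp: divisorial_hom_def hom_def)

lemma divisorial_hom_diff:
  assumes "\<phi> \<in> divisorial_hom K M N M' N'" and "real_module K M" "real_module K M'"
    and x: "x \<in> carrier M" and y: "y \<in> carrier M"
  shows "\<phi> (x \<ominus>\<^bsub>M\<^esub> y) = \<phi> x \<ominus>\<^bsub>M'\<^esub> \<phi> y"
proof -
  interpret M: real_module K M by fact
  interpret M': real_module K M' by fact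
  note \<phi> = divisorial_homD[OF assms(1)]
  have "x \<ominus>\<^bsub>M\<^esub> y = x \<oplus>\<^bsub>M\<^esub> (- 1) \<odot>\<^bsub>M\<^esub> y" "\<phi> x \<ominus>\<^bsub>M'\<^esub> \<phi> y = \<phi> x \<oplus>\<^bsub>M'\<^esub> (- 1) \<odot>\<^bsub>M'\<^esub> \<phi> y"
    using x y \<phi>(1) M.scalar_closed(2)
    by (simp_all add: M.M.minus_eq M'.M.minus_eq M.smult_uminus M'.smult_uminus M.smult_zero_one M'.smult_zero_one)
  moreover have "(- 1) \<odot>\<^bsub>M\<^esub> y \<in> carrier M" "- 1 \<in> K"
    using y M.scalar_uminus(2)[OF M.scalar_closed(2)] by simp_all
  ultimately show ?thesis
    using x y by (simp add: \<phi>(2,3))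
qed

text \<open>
  From \<open>- \<delta> b \<le> x - y \<le> \<delta> b\<close> follows \<open>- \<delta> \<phi> b \<le> \<phi> x - \<phi> y \<le> \<delta> \<phi> b\<close>, and \<open>\<delta> \<phi> b \<le> \<delta> b'\<close>.
\<close>

lemma divisorial_hom_nonexpanding:
  assumes \<phi>: "\<phi> \<in> divisorial_hom K M N M' N'" and "b_topology K M b" "b_topology K M' b'"
    and le: "\<phi> b \<preceq>\<^bsub>M'\<^esub> b'" and x: "x \<in> carrier M" and y: "y \<in> carrier M"
  shows "b_dist K M' b' (\<phi> x) (\<phi> y) \<le> b_dist K M b x y"
proof (rule ccontr)
  interpret M: b_topology K M b by fact
  interpret M': b_topology K M' b' by fact
  note \<phi>D = divisorial_homD[OF \<phi>]
  note \<phi>diff = divisorial_hom_diff[OF \<phi> M.real_module_axioms M'.real_module_axioms]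
  let ?e = "b_dist K M' b' (\<phi> x) (\<phi> y)"
  assume "\<not> ?e \<le> b_dist K M b x y"
  then obtain \<delta> where \<delta>: "\<delta> \<in> K" "0 \<le> \<delta>" "\<delta> < ?e" and bnd: "M.bounded_by \<delta> (x \<ominus>\<^bsub>M\<^esub> y)"
    using M.dist_less_iff[OF x y M'.dist_bounds(2)] by (meson not_le)
  let ?z = "\<phi> x \<ominus>\<^bsub>M'\<^esub> \<phi> y" and ?b = "\<delta> \<odot>\<^bsub>M'\<^esub> b'" and ?\<phi>b = "\<delta> \<odot>\<^bsub>M'\<^esub> \<phi> b"
  have z: "?z \<in> carrier M'" "\<phi> (x \<ominus>\<^bsub>M\<^esub> y) = ?z"
    using \<phi>D(1) x y \<phi>diff by simp_all
  have c: "?b \<in> carrier M'" "?\<phi>b \<in> carrier M'" "\<phi> b \<in> carrier M'"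
    using \<delta>(1) \<phi>D(1) M.b_carrier M'.b_carrier by simp_all
  have pos: "?b \<ominus>\<^bsub>M'\<^esub> ?\<phi>b \<in> nonneg_part M'"
    using M'.nonneg_smult[OF \<delta>(1,2)] le c M'.b_carrier \<delta>(1)
    by (simp add: M'.le_iff_diff M'.smult_diff_right[symmetric])
  have "?\<phi>b \<ominus>\<^bsub>M'\<^esub> ?z \<in> nonneg_part M'" "?\<phi>b \<oplus>\<^bsub>M'\<^esub> ?z \<in> nonneg_part M'"
  proof -
    have "\<phi> (\<delta> \<odot>\<^bsub>M\<^esub> b \<ominus>\<^bsub>M\<^esub> (x \<ominus>\<^bsub>M\<^esub> y)) \<in> nonneg_part M'" "\<phi> (\<delta> \<odot>\<^bsub>M\<^esub> b \<oplus>\<^bsub>M\<^esub> (x \<ominus>\<^bsub>M\<^esub> y)) \<in> nonneg_part M'"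
      using bnd \<phi>D(4) by (simp_all add: M.bounded_by_def)
    then show "?\<phi>b \<ominus>\<^bsub>M'\<^esub> ?z \<in> nonneg_part M'" "?\<phi>b \<oplus>\<^bsub>M'\<^esub> ?z \<in> nonneg_part M'"
      using \<delta>(1) x y M.b_carrier by (simp_all add: \<phi>diff \<phi>D(2,3))
  qed
  from M'.nonneg_add[OF pos this(1)] M'.nonneg_add[OF pos this(2)]
  have sums: "(?b \<ominus>\<^bsub>M'\<^esub> ?\<phi>b) \<oplus>\<^bsub>M'\<^esub> (?\<phi>b \<ominus>\<^bsub>M'\<^esub> ?z) \<in> nonneg_part M'"
    "(?b \<ominus>\<^bsub>M'\<^esub> ?\<phi>b) \<oplus>\<^bsub>M'\<^esub> (?\<phi>b \<oplus>\<^bsub>M'\<^esub> ?z) \<in> nonneg_part M'" .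
  have "(?b \<ominus>\<^bsub>M'\<^esub> ?\<phi>b) \<oplus>\<^bsub>M'\<^esub> (?\<phi>b \<ominus>\<^bsub>M'\<^esub> ?z) = ?b \<ominus>\<^bsub>M'\<^esub> ?z"
    "(?b \<ominus>\<^bsub>M'\<^esub> ?\<phi>b) \<oplus>\<^bsub>M'\<^esub> (?\<phi>b \<oplus>\<^bsub>M'\<^esub> ?z) = ?b \<oplus>\<^bsub>M'\<^esub> ?z"
    using c z(1) by algebra+
  then have "M'.bounded_by \<delta> ?z"
    using sums z(1) by (simp add: M'.bounded_by_def)
  then have "?e < ?e"
    using M'.dist_less_iff[OF \<phi>D(1)[OF x] \<phi>D(1)[OF y] M'.dist_bounds(2)] \<delta> by blast
  then show False by simp
qed

locale divisorial_extension =
  divisorial_b_topology K M N b + target: divisorial_b_topology K M' N' b'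
  for K and M :: "(real, 'a) ordered_module" and N b
    and M' :: "(real, 'c) ordered_module" and N' b' +
  fixes \<phi>
  assumes hom: "\<phi> \<in> divisorial_hom K M N M' N'"
    and complete: "hausdorff_complete N' (b_dist K M' b')"
    and closed: "closedin (pm_topology (carrier M') (b_dist K M' b')) (nonneg_part M')"
    and le: "\<phi> b \<preceq>\<^bsub>M'\<^esub> b'"
begin

lemmas hom_simps = divisorial_homD(1-3)[OF hom]
  divisorial_hom_diff[OF hom real_module_axioms target.real_module_axioms]

lemmas nonexpanding =
  divisorial_hom_nonexpanding[OF hom b_topology_axioms target.b_topology_axioms le]

text \<open>
  Two elements of \<open>M' = N' - N'\<close> have a common translate into \<open>N'\<close>, where distance \<open>0\<close> implies
  equality, and translation does not increase the distance.
\<close>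

lemma target_Hausdorff:
  assumes xy: "x \<in> carrier M'" "y \<in> carrier M'" and 0: "target.dist x y = 0"
  shows "x = y"
proof -
  obtain p q r s where x: "x = p \<ominus>\<^bsub>M'\<^esub> q" and y: "y = r \<ominus>\<^bsub>M'\<^esub> s"
    and N: "p \<in> N'" "q \<in> N'" "r \<in> N'" "s \<in> N'"
    using xy unfolding target.generating by (auto simp: differences_def)
  note c = N[THEN subsetD[OF target.N_subset]]
  interpret N': pseudo_metric N' target.dist
    by (rule target.pm.subspace[OF target.N_subset])
  have eq: "x \<oplus>\<^bsub>M'\<^esub> (q \<oplus>\<^bsub>M'\<^esub> s) = p \<oplus>\<^bsub>M'\<^esub> s" "y \<oplus>\<^bsub>M'\<^esub> (q \<oplus>\<^bsub>M'\<^esub> s) = r \<oplus>\<^bsub>M'\<^esub> q"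
    unfolding x y using c by algebra+
  have "target.dist (x \<oplus>\<^bsub>M'\<^esub> (q \<oplus>\<^bsub>M'\<^esub> s)) (y \<oplus>\<^bsub>M'\<^esub> (q \<oplus>\<^bsub>M'\<^esub> s))
      \<le> target.dist x y + target.dist (q \<oplus>\<^bsub>M'\<^esub> s) (q \<oplus>\<^bsub>M'\<^esub> s)"
    using xy c by (intro target.dist_add_le) simp_all
  also have "\<dots> = 0"
    using c by (simp add: 0 target.dist_refl)
  finally have "target.dist (p \<oplus>\<^bsub>M'\<^esub> s) (r \<oplus>\<^bsub>M'\<^esub> q) = 0"
    using target.dist_bounds(1) by (simp add: eq antisym)
  moreover have "p \<oplus>\<^bsub>M'\<^esub> s \<in> N'" "r \<oplus>\<^bsub>M'\<^esub> q \<in> N'"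
    using N target.cone by (simp_all add: is_cone_def)
  ultimately have "p \<oplus>\<^bsub>M'\<^esub> s = r \<oplus>\<^bsub>M'\<^esub> q"
    using complete N'.Hausdorff_dist_zero by (simp add: hausdorff_complete_def)
  then have "x \<oplus>\<^bsub>M'\<^esub> (q \<oplus>\<^bsub>M'\<^esub> s) = y \<oplus>\<^bsub>M'\<^esub> (q \<oplus>\<^bsub>M'\<^esub> s)"
    by (simp only: eq)
  then show "x = y"
    using xy c by simp
qed

text \<open>
  The graph of the extension. Working with a relation separates uniqueness of the value, which holds
  on the whole completion, from existence, which holds only on the differences of elements of the
  completed cone.
\<close>

definition is_image_limit where
  "is_image_limit X y \<longleftrightarrow> y \<in> carrier M' \<and>
    (\<exists>\<sigma>. Cauchy_seq \<sigma> \<and> X = cls \<sigma> \<and> (\<lambda>n. target.dist (\<phi> (\<sigma> n)) y) \<longlonglongrightarrow> 0)"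

lemma is_image_limitI:
  "\<lbrakk>Cauchy_seq \<sigma>; X = cls \<sigma>; y \<in> carrier M'; (\<lambda>n. target.dist (\<phi> (\<sigma> n)) y) \<longlonglongrightarrow> 0\<rbrakk> \<Longrightarrow> is_image_limit X y"
  by (auto simp: is_image_limit_def)

lemma is_image_limitE:
  assumes "is_image_limit X y"
  obtains \<sigma> where "Cauchy_seq \<sigma>" "X = cls \<sigma>" "y \<in> carrier M'" "(\<lambda>n. target.dist (\<phi> (\<sigma> n)) y) \<longlonglongrightarrow> 0"
  using assms by (auto simp: is_image_limit_def)

text \<open>
  The limit may be taken along any representative, because \<open>\<phi>\<close> does not increase distances.
\<close>

lemma is_image_limit_representative:
  assumes "is_image_limit X y" "Cauchy_seq \<tau>" "X = cls \<tau>"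
  shows "(\<lambda>n. target.dist (\<phi> (\<tau> n)) y) \<longlonglongrightarrow> 0"
proof -
  obtain \<sigma> where s: "Cauchy_seq \<sigma>" "X = cls \<sigma>" "y \<in> carrier M'"
    and lim: "(\<lambda>n. target.dist (\<phi> (\<sigma> n)) y) \<longlonglongrightarrow> 0"
    using assms(1) by (rule is_image_limitE)
  note c = s(1)[THEN pm.CauchyD] assms(2)[THEN pm.CauchyD]
  have "(\<lambda>n. dist (\<tau> n) (\<sigma> n)) \<longlonglongrightarrow> 0"
    using pm.cls_eq_iff[OF assms(2) s(1)] s(2) assms(3) by simp
  from tendsto_add[OF this lim] have "(\<lambda>n. dist (\<tau> n) (\<sigma> n) + target.dist (\<phi> (\<sigma> n)) y) \<longlonglongrightarrow> 0"
    by simp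
  then show ?thesis
  proof (rule null_squeeze[OF _ target.dist_bounds(1)])
    fix n
    have "target.dist (\<phi> (\<tau> n)) y \<le> target.dist (\<phi> (\<tau> n)) (\<phi> (\<sigma> n)) + target.dist (\<phi> (\<sigma> n)) y"
      using c s(3) by (intro target.dist_triangle) (simp_all add: hom_simps)
    also have "\<dots> \<le> dist (\<tau> n) (\<sigma> n) + target.dist (\<phi> (\<sigma> n)) y"
      using c nonexpanding by simp
    finally show "target.dist (\<phi> (\<tau> n)) y \<le> \<dots>" .
  qed
qed

lemma is_image_limit_unique:
  assumes "is_image_limit X y" "is_image_limit X z"
  shows "y = z"
proof -
  obtain \<sigma> where s: "Cauchy_seq \<sigma>" "X = cls \<sigma>" "y \<in> carrier M'"
    and lim: "(\<lambda>n. target.dist (\<phi> (\<sigma> n)) y) \<longlonglongrightarrow> 0"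
    using assms(1) by (rule is_image_limitE)
  have z: "z \<in> carrier M'" using assms(2) by (simp add: is_image_limit_def)
  have "(\<lambda>n. target.dist (\<phi> (\<sigma> n)) y + target.dist (\<phi> (\<sigma> n)) z) \<longlonglongrightarrow> 0"
    using tendsto_add[OF lim is_image_limit_representative[OF assms(2) s(1,2)]] by simp
  then have "(\<lambda>n. target.dist y z) \<longlonglongrightarrow> 0"
  proof (rule null_squeeze[OF _ target.dist_bounds(1)])
    show "target.dist y z \<le> target.dist (\<phi> (\<sigma> n)) y + target.dist (\<phi> (\<sigma> n)) z" for n
      using target.dist_triangle[of y "\<phi> (\<sigma> n)" z] s z pm.CauchyD[OF s(1)]
      by (simp add: hom_simps target.dist_commute[of y])
  qed
  then show ?thesis
    using target_Hausdorff s(3) z by (simp add: LIMSEQ_const_iff)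
qed

lemma is_image_limit_add:
  assumes "is_image_limit X y" "is_image_limit X' y'"
  shows "is_image_limit (X \<oplus>\<^bsub>C\<^esub> X') (y \<oplus>\<^bsub>M'\<^esub> y')"
proof -
  obtain \<sigma> where s: "Cauchy_seq \<sigma>" "X = cls \<sigma>" "y \<in> carrier M'" "(\<lambda>n. target.dist (\<phi> (\<sigma> n)) y) \<longlonglongrightarrow> 0"
    using assms(1) by (rule is_image_limitE)
  obtain \<tau> where t: "Cauchy_seq \<tau>" "X' = cls \<tau>" "y' \<in> carrier M'" "(\<lambda>n. target.dist (\<phi> (\<tau> n)) y') \<longlonglongrightarrow> 0"
    using assms(2) by (rule is_image_limitE)
  note c = s(1)[THEN pm.CauchyD] t(1)[THEN pm.CauchyD]
  have "(\<lambda>n. target.dist (\<phi> (\<sigma> n)) y + target.dist (\<phi> (\<tau> n)) y') \<longlonglongrightarrow> 0"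
    using tendsto_add[OF s(4) t(4)] by simp
  then have "(\<lambda>n. target.dist (\<phi> (\<sigma> n \<oplus>\<^bsub>M\<^esub> \<tau> n)) (y \<oplus>\<^bsub>M'\<^esub> y')) \<longlonglongrightarrow> 0"
  proof (rule null_squeeze[OF _ target.dist_bounds(1)])
    show "target.dist (\<phi> (\<sigma> n \<oplus>\<^bsub>M\<^esub> \<tau> n)) (y \<oplus>\<^bsub>M'\<^esub> y')
        \<le> target.dist (\<phi> (\<sigma> n)) y + target.dist (\<phi> (\<tau> n)) y'" for n
      using target.dist_add_le[of "\<phi> (\<sigma> n)" y "\<phi> (\<tau> n)" y'] c s(3) t(3) by (simp add: hom_simps)
  qed
  then show ?thesis
    using s(3) t(3) C_add[OF s(1) t(1)] s(2) t(2)
    by (intro is_image_limitI[OF Cauchy_add[OF s(1) t(1)]]) simp_all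
qed

lemma is_image_limit_smult:
  assumes "a \<in> K" "is_image_limit X y"
  shows "is_image_limit (a \<odot>\<^bsub>C\<^esub> X) (a \<odot>\<^bsub>M'\<^esub> y)"
proof -
  obtain \<sigma> where s: "Cauchy_seq \<sigma>" "X = cls \<sigma>" "y \<in> carrier M'" "(\<lambda>n. target.dist (\<phi> (\<sigma> n)) y) \<longlonglongrightarrow> 0"
    using assms(2) by (rule is_image_limitE)
  note c = s(1)[THEN pm.CauchyD]
  have "(\<lambda>n. max 1 \<bar>a\<bar> * target.dist (\<phi> (\<sigma> n)) y) \<longlonglongrightarrow> 0"
    by (rule tendsto_mult_right_zero) (rule s(4))
  then have "(\<lambda>n. target.dist (\<phi> (a \<odot>\<^bsub>M\<^esub> \<sigma> n)) (a \<odot>\<^bsub>M'\<^esub> y)) \<longlonglongrightarrow> 0"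
  proof (rule null_squeeze[OF _ target.dist_bounds(1)])
    show "target.dist (\<phi> (a \<odot>\<^bsub>M\<^esub> \<sigma> n)) (a \<odot>\<^bsub>M'\<^esub> y) \<le> max 1 \<bar>a\<bar> * target.dist (\<phi> (\<sigma> n)) y" for n
      using target.dist_smult_le[of a "\<phi> (\<sigma> n)" y] c s(3) assms(1) by (simp add: hom_simps)
  qed
  then show ?thesis
    using s(3) C_smult[OF assms(1) s(1)] s(2) assms(1)
    by (intro is_image_limitI[OF Cauchy_smult[OF assms(1) s(1)]]) simp_all
qed

lemma is_image_limit_diff:
  assumes "is_image_limit X y" "is_image_limit X' y'" and "X' \<in> carrier C"
  shows "is_image_limit (X \<ominus>\<^bsub>C\<^esub> X') (y \<ominus>\<^bsub>M'\<^esub> y')"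
proof -
  have K: "- 1 \<in> K" "1 \<in> K" using scalar_uminus(2)[OF scalar_closed(2)] scalar_closed(2) by simp_all
  have y': "y' \<in> carrier M'" using assms(2) by (simp add: is_image_limit_def)
  from is_image_limit_add[OF assms(1) is_image_limit_smult[OF K(1) assms(2)]] show ?thesis
    using assms(3) y' K(2)
    by (simp add: C.smult_uminus target.smult_uminus C.smult_zero_one target.smult_zero_one
        C.M.minus_eq target.M.minus_eq)
qed

lemma is_image_limit_natural_map: "x \<in> carrier M \<Longrightarrow> is_image_limit (iota x) (\<phi> x)"
  by (rule is_image_limitI[of "\<lambda>n. x"])
    (simp_all add: pm.Cauchy_const natural_map_eq hom_simps target.dist_refl)

text \<open>
  This is where completeness of \<open>N'\<close> is used.
\<close>

lemma is_image_limit_Nh: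
  assumes "X \<in> Nh"
  obtains y where "y \<in> N'" "is_image_limit X y"
proof -
  obtain \<sigma> where s: "Cauchy_seq \<sigma>" "range \<sigma> \<subseteq> N" "X = cls \<sigma>"
    using assms unfolding mem_subset_completion_iff[OF N_subset] by blast
  note c = s(1)[THEN pm.CauchyD]
  interpret N': pseudo_metric N' target.dist
    by (rule target.pm.subspace[OF target.N_subset])
  have N': "\<phi> (\<sigma> n) \<in> N'" for n
    using s(2) divisorial_homD(5)[OF hom] by auto
  have "pm_Cauchy N' target.dist (\<lambda>n. \<phi> (\<sigma> n))"
  proof (rule pm_Cauchy_dominated[OF s(1) s(1) N', where c = 1])
    show "target.dist (\<phi> (\<sigma> m)) (\<phi> (\<sigma> n)) \<le> 1 * (dist (\<sigma> m) (\<sigma> n) + dist (\<sigma> m) (\<sigma> n))" for m n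
      using nonexpanding[of "\<sigma> m" "\<sigma> n"] c dist_bounds(1)[of "\<sigma> m" "\<sigma> n"] by simp
  qed simp
  then obtain y where "limitin (pm_topology N' target.dist) (\<lambda>n. \<phi> (\<sigma> n)) y sequentially"
    using complete by (auto simp: hausdorff_complete_def pm_complete_def)
  moreover have "range (\<lambda>n. \<phi> (\<sigma> n)) \<subseteq> N'" using N' by blast
  ultimately have "y \<in> N'" "(\<lambda>n. target.dist (\<phi> (\<sigma> n)) y) \<longlonglongrightarrow> 0"
    by (simp_all add: N'.limitin_pm_topology)
  then show thesis
    using that is_image_limitI[OF s(1) s(3)] target.N_subset by blast
qed

lemma Nh_carrier_C: "X \<in> Nh \<Longrightarrow> X \<in> carrier C"
  using is_cone_Nh unfolding is_cone_def by blast

lemma carrier_H_cases: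
  assumes "X \<in> carrier H"
  obtains Y Z where "Y \<in> Nh" "Z \<in> Nh" "X = Y \<ominus>\<^bsub>C\<^esub> Z"
  using assms unfolding H_simps(1) hat_carrier_def differences_def by blast

lemma is_image_limit_exists:
  assumes "X \<in> carrier H"
  shows "\<exists>y. is_image_limit X y"
proof -
  obtain Y Z where YZ: "Y \<in> Nh" "Z \<in> Nh" "X = Y \<ominus>\<^bsub>C\<^esub> Z"
    using assms by (rule carrier_H_cases)
  obtain y where "is_image_limit Y y" using YZ(1) by (rule is_image_limit_Nh)
  moreover obtain z where "is_image_limit Z z" using YZ(2) by (rule is_image_limit_Nh)
  ultimately show ?thesis
    using is_image_limit_diff Nh_carrier_C[OF YZ(2)] YZ(3) by blast
qed

text \<open>
  By independence of the representative the limit can be taken along a nonnegative sequence, and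
  \<open>M'\<^sub>\<ge>\<^sub>0\<close> is closed.
\<close>

lemma is_image_limit_nonneg:
  assumes "is_image_limit X y" "X \<in> subset_completion K M b P"
  shows "y \<in> nonneg_part M'"
proof -
  have PM: "P \<subseteq> carrier M" using nonneg_carrier by blast
  obtain \<tau> where t: "Cauchy_seq \<tau>" "range \<tau> \<subseteq> P" "X = cls \<tau>"
    using assms(2) unfolding mem_subset_completion_iff[OF PM] by blast
  show ?thesis
  proof (rule target.pm.closedin_limit[OF closed])
    show "range (\<lambda>n. \<phi> (\<tau> n)) \<subseteq> nonneg_part M'"
      using t(2) divisorial_homD(4)[OF hom] by auto
    show "y \<in> carrier M'" using assms(1) by (simp add: is_image_limit_def)
  qed (rule is_image_limit_representative[OF assms(1) t(1,3)])
qed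

definition extension where
  "extension = restrict (\<lambda>X. THE y. is_image_limit X y) (carrier H)"

lemma is_image_limit_extension:
  assumes "X \<in> carrier H"
  shows "is_image_limit X (extension X)"
proof -
  obtain y where y: "is_image_limit X y" using is_image_limit_exists[OF assms] by blast
  then have "(THE y. is_image_limit X y) = y"
    using is_image_limit_unique by blast
  then show ?thesis using y assms by (simp add: extension_def)
qed

lemma extension_eqI: "\<lbrakk>X \<in> carrier H; is_image_limit X y\<rbrakk> \<Longrightarrow> extension X = y"
  using is_image_limit_unique is_image_limit_extension by blast

lemma extension_hom: "extension \<in> divisorial_hom K H Nh M' N'"
proof -
  have "extension \<in> hom (add_monoid H) (add_monoid M')"
  proof (rule homI)
    fix X assume "X \<in> carrier (add_monoid H)"
    then show "extension X \<in> carrier (add_monoid M')"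
      using is_image_limit_extension by (simp add: is_image_limit_def)
    fix Y assume "Y \<in> carrier (add_monoid H)"
    then show "extension (X \<otimes>\<^bsub>add_monoid H\<^esub> Y) = extension X \<otimes>\<^bsub>add_monoid M'\<^esub> extension Y"
      using \<open>X \<in> carrier (add_monoid H)\<close> is_image_limit_add[OF is_image_limit_extension is_image_limit_extension, of X Y]
        H.M.a_closed[of X Y]
      by (simp add: H_simps(2)) (intro extension_eqI; simp add: H_simps(2))
  qed
  moreover have "extension (a \<odot>\<^bsub>H\<^esub> X) = a \<odot>\<^bsub>M'\<^esub> extension X" if "a \<in> K" "X \<in> carrier H" for a X
    using that H.smult_closed[of a X] is_image_limit_smult[OF that(1) is_image_limit_extension[OF that(2)]]
    by (intro extension_eqI) (simp_all add: H_simps(4))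
  moreover have "extension X \<in> nonneg_part M'" if "X \<in> Ph" for X
    using that by (intro is_image_limit_nonneg[of X] is_image_limit_extension) (simp_all add: hat_nonneg_def H_simps(1))
  moreover have "extension X \<in> N'" if X: "X \<in> Nh" for X
  proof -
    obtain y where "y \<in> N'" "is_image_limit X y" using X by (rule is_image_limit_Nh)
    then show ?thesis using extension_eqI X Nh_subset_H by blast
  qed
  ultimately show ?thesis
    by (auto simp: divisorial_hom_def nonneg_part_H)
qed

lemma extension_natural_map: "x \<in> carrier M \<Longrightarrow> extension (iota x) = \<phi> x"
  by (intro extension_eqI natural_map_carrier is_image_limit_natural_map)

text \<open>
  The uniqueness part: every morphism that extends \<open>\<phi>\<close> is continuous for the completed metric, so
  it commutes with the limit that defines the graph.
\<close>

lemma is_image_limit_of_morphism: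
  assumes \<psi>: "\<psi> \<in> divisorial_hom K H Nh M' N'" "\<And>x. x \<in> carrier M \<Longrightarrow> \<psi> (iota x) = \<phi> x"
    and X: "X \<in> carrier H"
  shows "is_image_limit X (\<psi> X)"
proof -
  have XC: "X \<in> carrier C" using X hat_carrierE(1) by (auto simp: H_simps(1))
  then obtain \<sigma> where s: "Cauchy_seq \<sigma>" "X = cls \<sigma>" by (rule C_cases)
  note c = s(1)[THEN pm.CauchyD]
  have le': "\<psi> (iota b) \<preceq>\<^bsub>M'\<^esub> b'" using le \<psi>(2) b_carrier by simp
  have "(\<lambda>n. b_completion_dist K M b (iota (\<sigma> n)) X) \<longlonglongrightarrow> 0"
    using pm.completion_map_tendsto_cls[OF s(1)] s(2) by (simp add: b_completion_dist_def natural_map_def)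
  then have "(\<lambda>n. target.dist (\<phi> (\<sigma> n)) (\<psi> X)) \<longlonglongrightarrow> 0"
  proof (rule null_squeeze[OF _ target.dist_bounds(1)])
    fix n
    have "target.dist (\<psi> (iota (\<sigma> n))) (\<psi> X) \<le> b_dist K H (iota b) (iota (\<sigma> n)) X"
      by (intro divisorial_hom_nonexpanding[OF \<psi>(1) b_topology_H target.b_topology_axioms le']
          natural_map_carrier c X)
    also have "\<dots> \<le> b_completion_dist K M b (iota (\<sigma> n)) X"
      by (intro dist_H_le natural_map_carrier c X)
    finally show "target.dist (\<phi> (\<sigma> n)) (\<psi> X) \<le> b_completion_dist K M b (iota (\<sigma> n)) X"
      using \<psi>(2) c by simp
  qed
  then show ?thesis
    using s divisorial_homD(1)[OF \<psi>(1) X] by (intro is_image_limitI)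
qed

lemma ex1_extension:
  "\<exists>!\<psi>. \<psi> \<in> extensional (carrier H) \<and> \<psi> \<in> divisorial_hom K H Nh M' N' \<and>
     (\<forall>x\<in>carrier M. \<psi> (iota x) = \<phi> x)"
proof (rule ex1I[of _ extension])
  show "extension \<in> extensional (carrier H) \<and> extension \<in> divisorial_hom K H Nh M' N' \<and>
     (\<forall>x\<in>carrier M. extension (iota x) = \<phi> x)"
    using extension_hom extension_natural_map by (simp add: extension_def)
next
  fix \<psi> assume \<psi>: "\<psi> \<in> extensional (carrier H) \<and> \<psi> \<in> divisorial_hom K H Nh M' N' \<and>
     (\<forall>x\<in>carrier M. \<psi> (iota x) = \<phi> x)"
  show "\<psi> = extension"
  proof (rule extensionalityI)
    show "\<psi> \<in> extensional (carrier H)" using \<psi> by blast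
    show "extension \<in> extensional (carrier H)" by (simp add: extension_def)
    show "\<psi> X = extension X" if "X \<in> carrier H" for X
      using is_image_limit_of_morphism[of \<psi> X] \<psi> that extension_eqI by simp
  qed
qed

end

theorem proposition2p22:
  fixes K :: "real set" and M :: "(real, 'a) ordered_module" and N :: "'a set" and b :: 'a
  assumes "K = \<rat> \<or> K = \<real>"
    and "abstract_divisorial_space K M N"
    and "b \<in> nonneg_part M"
  shows "let Nh = subset_completion K M b N;
             Mh = hat_space K M N b;
             Mh_nonneg = hat_nonneg K M N b;
             \<iota> = natural_map K M b
    in is_cone K (b_completion K M b) Nh \<and>
       hausdorff_complete Nh (b_completion_dist K M b) \<and>
       is_cone K (b_completion K M b) Mh_nonneg \<and>
       closedin (subtopology (b_completion_topology K M b) (carrier Mh)) Mh_nonneg \<and>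
       abstract_divisorial_space K Mh Nh \<and>
       \<iota> \<in> divisorial_hom K M N Mh Nh \<and>
       (\<forall>(M' :: (real, 'c) ordered_module) N' b' \<phi>.
          abstract_divisorial_space K M' N' \<longrightarrow> b' \<in> nonneg_part M' \<longrightarrow>
          \<phi> \<in> divisorial_hom K M N M' N' \<longrightarrow>
          hausdorff_complete N' (b_dist K M' b') \<longrightarrow>
          closedin (pm_topology (carrier M') (b_dist K M' b')) (nonneg_part M') \<longrightarrow>
          \<phi> b \<preceq>\<^bsub>M'\<^esub> b' \<longrightarrow>
          (\<exists>!\<psi>. \<psi> \<in> extensional (carrier Mh) \<and> \<psi> \<in> divisorial_hom K Mh Nh M' N' \<and>
                (\<forall>x\<in>carrier M. \<psi> (\<iota> x) = \<phi> x)))"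
proof -
  \<comment> \<open>Stated for an arbitrary space, because it is applied to \<open>M\<close> and to \<open>M'\<close>.\<close>
  have locale_intro: "divisorial_b_topology K L N0 c"
    if "abstract_divisorial_space K L N0" "c \<in> nonneg_part L" for L :: "(real, 'x) ordered_module" and N0 c
    using that assms(1)
    by (intro divisorial_b_topology.intro b_topology.intro b_topology_axioms.intro)
      (simp_all add: abstract_divisorial_space_def)
  interpret divisorial_b_topology K M N b
    using assms by (intro locale_intro)
  show ?thesis
    unfolding Let_def
  proof (intro conjI allI impI)
    show "is_cone K C Nh" by (rule is_cone_Nh)
    show "hausdorff_complete Nh (b_completion_dist K M b)"
      by (rule hausdorff_complete_subset_completion[OF N_subset])
    show "is_cone K C Ph" by (rule is_cone_Ph)
    show "closedin (subtopology (b_completion_topology K M b) (carrier H)) Ph" by (rule closedin_Ph)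
    show "abstract_divisorial_space K H Nh" by (rule abstract_divisorial_space_H)
    show "iota \<in> divisorial_hom K M N H Nh" by (rule natural_map_hom)
  next
    fix M' :: "(real, 'c) ordered_module" and N' b' \<phi>
    assume "abstract_divisorial_space K M' N'" "b' \<in> nonneg_part M'"
      and "\<phi> \<in> divisorial_hom K M N M' N'" "hausdorff_complete N' (b_dist K M' b')"
      and "closedin (pm_topology (carrier M') (b_dist K M' b')) (nonneg_part M')"
      and "\<phi> b \<preceq>\<^bsub>M'\<^esub> b'"
    then interpret divisorial_extension K M N b M' N' b' \<phi>
      by (intro divisorial_extension.intro divisorial_extension_axioms.intro locale_intro assms)
    show "\<exists>!\<psi>. \<psi> \<in> extensional (carrier H) \<and> \<psi> \<in> divisorial_hom K H Nh M' N' \<and>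
                (\<forall>x\<in>carrier M. \<psi> (iota x) = \<phi> x)"
      by (rule ex1_extension)
  qed
qed

end
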